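(* Let $0<s<1$. Assume $f:[0,\infty)\to\mathbb{R}$ is a $C^1$ function satisfying $f'\le0$, and consider nonnegative bounded solutions $u\in(C^{1,1}_{loc}\cap\mathcal{L}_{2s})\times C^1(\mathbb{R})$ of $$(\mathrm{W})\qquad\frac{\partial u}{\partial t}(x,t)+(-\Delta)^s u(x,t)=f(u(x,t)),\qquad (x,t)\in\mathbb{R}^n\times\mathbb{R}.$$ Then: (i) Every such solution $u$ is independent of the spatial variables $x_i$ $(1\le i\le n)$, i.e. $u=u(t)$ and $$u_t=f(u(t)),\qquad\forall\,t\in\mathbb{R}.$$ (ii) Assume $f(c)=0$ if and only if $c=0$. Then the only nonnegative bounded solution of $(\mathrm{W})$ is the trivial solution $u\equiv0$. (iii) Assume $f(c)<0$ for all $c\ge0$. Then a nonnegative bounded solution of $(\mathrm{W})$ does not exist.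
   Context: For each fixed $t$, the fractional Laplacian acts in $x\in\mathbb{R}^n$ by $$(-\Delta)^s u(x,t)=C_{n,s}\,\lim_{\varepsilon\to0^+}\int_{\mathbb{R}^n\setminus B_\varepsilon(x)}\frac{u(x,t)-u(y,t)}{|x-y|^{n+2s}}\,dy,\qquad C_{n,s}=\left(\int_{\mathbb{R}^n}\frac{1-\cos(2\pi\zeta_1)}{|\zeta|^{n+2s}}d\zeta\right)^{-1}.$$ $\mathcal{L}_{2s}$ is the set of $u$ with $u(\cdot,t)\in L^1_{loc}(\mathbb{R}^n)$ and $\int_{\mathbb{R}^n}\frac{|u(x,t)|}{1+|x|^{n+2s}}dx<+\infty$; $C^{1,1}_{loc}$ means $C^{1,1}_{loc}(\mathbb{R}^n)$. The notation $u\in(X)\times C^1(\mathbb{R})$ means that $u(\cdot,t)$ lies in the space $X$ of functions of $x$ for each $t\in\mathbb{R}$ and $u(x,\cdot)\in C^1(\mathbb{R})$ for each $x$. *)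

theory Defs
  imports "HOL-Analysis.Analysis"
begin

definition frac_kernel :: "real \<Rightarrow> real ^ 'n \<Rightarrow> real"
  where "frac_kernel s z = norm z powr (real CARD('n) + 2 * s)"

text \<open>An index type has no distinguished first element, so an arbitrary fixed coordinate plays the
  role of \<open>\<zeta>\<^sub>1\<close>; by symmetry the integral is the same for every coordinate.\<close>

definition frac_laplacian_const :: "'n::finite itself \<Rightarrow> real \<Rightarrow> real"
  where "frac_laplacian_const _ s =
    inverse (LINT z::real ^ 'n|lebesgue.
      (1 - cos (2 * pi * z $ (SOME i. True))) / frac_kernel s z)"

text \<open>The limit exists whenever \<open>v\<close> belongs to both classes \<open>C11_loc\<close> and \<open>L2s s\<close> below.\<close>

definition frac_laplacian :: "real \<Rightarrow> (real ^ 'n \<Rightarrow> real) \<Rightarrow> real ^ 'n \<Rightarrow> real"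
  where "frac_laplacian s v x =
    frac_laplacian_const TYPE('n) s *
      Lim (at_right 0) (\<lambda>\<epsilon>. LINT y:- ball x \<epsilon>|lebesgue. (v x - v y) / frac_kernel s (x - y))"

definition C11_loc :: "(real ^ 'n \<Rightarrow> real) set"
  where "C11_loc = {v. \<exists>g. (\<forall>x. GDERIV v x :> g x) \<and>
    (\<forall>K. compact K \<longrightarrow> (\<exists>L. L-lipschitz_on K g))}"

definition L2s :: "real \<Rightarrow> (real ^ 'n \<Rightarrow> real) set"
  where "L2s s = {v. (\<forall>K. compact K \<longrightarrow> v absolutely_integrable_on K) \<and>
    integrable lebesgue (\<lambda>x. \<bar>v x\<bar> / (1 + frac_kernel s x))}"

text \<open>The regularity is separate in \<open>x\<close> and \<open>t\<close>; no joint continuity is required.\<close>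

definition nonneg_bounded_solution ::
    "real \<Rightarrow> (real \<Rightarrow> real) \<Rightarrow> (real ^ 'n \<Rightarrow> real \<Rightarrow> real) \<Rightarrow> bool"
  where "nonneg_bounded_solution s f u \<longleftrightarrow>
    (\<forall>t. (\<lambda>x. u x t) \<in> C11_loc \<inter> L2s s) \<and>
    (\<forall>x. u x C1_differentiable_on UNIV) \<and>
    (\<forall>x t. u x t \<ge> 0) \<and>
    bounded (range (\<lambda>(x, t). u x t)) \<and>
    (\<forall>x t. deriv (u x) t + frac_laplacian s (\<lambda>y. u y t) x = f (u x t))"

end

theory Submission
  imports Defs
begin

text \<open>Fix a translation \<open>h\<close> and put \<open>w(x,t) = u(x+h,t) - u(x,t)\<close>.  Since \<open>f\<close> is nonincreasing, \<open>w\<close>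
satisfies \<open>w\<^sub>t + (-\<Delta>)\<^sup>s w \<le> 0\<close> wherever \<open>w \<ge> 0\<close>.  Suppose that \<open>M = sup w\<close> is positive.  At a
spatial maximum of \<open>w(\<cdot>,t)\<close> with value close to \<open>M\<close> the nonlocal term is bounded below by a fixed \<open>\<kappa> > 0\<close>:
the sum of \<open>w(x+z+kh,t)\<close> over \<open>k = 1,\<dots>,n\<close> telescopes to a difference of two values of \<open>u\<close>, hence
is at most the bound \<open>K\<close> of \<open>u\<close>, so that \<open>w\<close> lies well below \<open>M\<close> on a substantial part of a
fixed neighbourhood (lemma \<open>frac_op_ge_at_max\<close>).  Therefore \<open>w\<^sub>t\<close> is at most a negative constant
there, and going backward in time the localised maximum of \<open>w\<close> grows linearly until it exceeds
\<open>M\<close>, which is absurd (lemma \<open>translate_le\<close>).  So \<open>u\<close> depends on \<open>t\<close> only, and (ii) and (iii) are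
facts about bounded nonnegative solutions of \<open>U' = f(U)\<close> on the whole line
(lemma \<open>bounded_ancient_no_decay\<close>).

The backward argument needs the localised maximum to be semicontinuous along decreasing times,
whereas the solution is only separately regular: \<open>C\<^sup>1\<^sup>,\<^sup>1\<close> in \<open>x\<close> for each \<open>t\<close> and differentiable in \<open>t\<close>
for each \<open>x\<close>, with no uniformity.  The missing statement is that \<open>u(x,b) - u(x,a)\<close> is \<open>O(b-a)\<close>,
locally uniformly in \<open>x\<close>, for each fixed \<open>a\<close> and all \<open>b > a\<close>
(lemma \<open>locally_uniform_right_lipschitz\<close>).  It follows from a barrier, because \<open>u(\<cdot>,a)\<close> has bounded
second differences on balls; but a barrier argument must find a maximum in \<open>(x,t)\<close>, and \<open>u\<close> is not
known to be jointly continuous.  So the barrier is applied to spatial mollifications \<open>u\<^sub>r\<close> of \<open>u\<close>,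
which are jointly continuous because \<open>u\<close> is bounded.  What has to be shown is that \<open>u\<^sub>r\<close> satisfies
the mollified equation at every time; without domination in \<open>t\<close>, differentiation under the
integral sign is not available at once.

This is settled by Baire's theorem (lemma \<open>moll_evolves_everywhere\<close>).  Let \<open>E\<close> be the
closure of the set of times at which the mollified equation fails, and suppose that it is nonempty.
The sets of times at which the second differences of \<open>u(\<cdot>,t)\<close> on a ball are bounded by
\<open>N|z|\<^sup>2\<close> are closed and exhaust the line, so there is an open interval \<open>J\<close> meeting \<open>E\<close> such that
\<open>E \<inter> J\<close> lies in one of them.  The barrier controls \<open>u\<close> on every gap of \<open>E\<close> by its data at the left
end of the gap, the equation controls \<open>u\<^sub>t\<close> at the points of \<open>E\<close>, and continuous induction combines
the two into \<open>|u(x,b) - u(x,a)| \<le> B(b-a)\<close> for \<open>a\<close> in \<open>E \<inter> J\<close> and \<open>b > a\<close> in \<open>J\<close>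
(lemma \<open>right_lipschitz\<close>).  This is the domination needed to compute the right derivative of \<open>u\<^sub>r\<close> at
\<open>a\<close>.  A continuous function whose right derivative is continuous is differentiable, so the
mollified equation holds on all of \<open>J\<close>, contradicting \<open>E \<inter> J \<noteq> \<emptyset>\<close>.\<close>

section \<open>Integrability of the kernel\<close>

text \<open>The size of a second difference of a bounded \<open>C\<^sup>1\<^sup>,\<^sup>1\<close> function; divided by the kernel it is integrable
both at the origin (as \<open>s < 1\<close>) and at infinity (as \<open>s > 0\<close>).\<close>

definition trunc_sq :: "'a::real_normed_vector \<Rightarrow> real"
  where "trunc_sq z = min 1 ((norm z)\<^sup>2)"

lemma trunc_sq_nonneg [simp]: "0 \<le> trunc_sq z"
  by (simp add: trunc_sq_def)

lemma trunc_sq_le: "trunc_sq z \<le> 1" "trunc_sq z \<le> (norm z)\<^sup>2"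
  by (simp_all add: trunc_sq_def)

lemma trunc_sq_measurable [measurable]: "trunc_sq \<in> borel_measurable borel"
  unfolding trunc_sq_def[abs_def] by measurable

lemma frac_kernel_measurable [measurable]: "frac_kernel s \<in> borel_measurable borel"
  unfolding frac_kernel_def[abs_def] by measurable

lemma frac_kernel_nonneg [simp]: "0 \<le> frac_kernel s z"
  by (simp add: frac_kernel_def)

lemma frac_kernel_minus [simp]: "frac_kernel s (- z) = frac_kernel s z"
  by (simp add: frac_kernel_def)

lemma dyadic_scale:
  fixes r :: real
  assumes "1 \<le> r"
  obtains j where "2 ^ j \<le> r" "r < 2 ^ Suc j"
proof -
  obtain n0 where "r < 2 ^ n0" using real_arch_pow[of 2 r] by auto
  define n where "n = (LEAST n. r < 2 ^ n)"
  have n: "r < 2 ^ n" unfolding n_def by (rule LeastI) fact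
  have "n \<noteq> 0" using n assms by (intro notI) simp
  then obtain j where j: "n = Suc j" by (cases n) auto
  have "\<not> r < 2 ^ j" using not_less_Least[of j "\<lambda>n. r < 2 ^ n"] j unfolding n_def by simp
  then show ?thesis using that[of j] n j by simp
qed

text \<open>Dyadic decomposition: on the shell where \<open>|z|\<close> is about \<open>2\<^sup>j\<close> the integrand times the volume is a
multiple of \<open>(2\<^sup>-\<^sup>2\<^sup>s)\<^sup>j\<close>, and on the shell where it is about \<open>2\<^sup>-\<^sup>j\<close> a multiple of \<open>(2\<^sup>2\<^sup>s\<^sup>-\<^sup>2)\<^sup>j\<close>; both are
geometric series.\<close>

lemma kernel_integrable:
  assumes s: "0 < s" "s < 1"
  shows "integrable lborel (\<lambda>z::real ^ 'n. trunc_sq z / frac_kernel s z)"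
proof (rule integrableI_bounded)
  define d where "d = real CARD('n)"
  define p where "p = d + 2 * s"
  have d: "d > 0" unfolding d_def by simp
  have p: "p > 0" using d s unfolding p_def by simp
  define A where "A j = 2 powr (- p * real j)" for j :: nat
  define B where "B j = 2 powr (p - (2 - p) * real j)" for j :: nat
  define a where "a j = ball (0::real ^ 'n) (2 ^ Suc j)" for j :: nat
  define b where "b j = ball (0::real ^ 'n) (2 powr (1 - real j))" for j :: nat
  define G where "G j z = ennreal (A j) * indicator (a j) z + ennreal (B j) * indicator (b j) z"
    for j z
  have le_sum: "G j z \<le> (\<Sum>j. G j z)" for j z
    using sum_le_suminf[OF summableI, of "{j}" "\<lambda>j. G j z"] by simp
  have pw: "ennreal (norm (trunc_sq z / frac_kernel s z)) \<le> (\<Sum>j. G j z)" for z :: "real ^ 'n"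
  proof -
    define r where "r = norm z"
    consider "r = 0" | "r \<ge> 1" | "0 < r" "r < 1" unfolding r_def by fastforce
    then show ?thesis
    proof cases
      case 1
      then show ?thesis unfolding r_def by (simp add: trunc_sq_def)
    next
      case 2
      obtain j where j: "2 ^ j \<le> r" "r < 2 ^ Suc j" using dyadic_scale[OF 2] by blast
      have "trunc_sq z / frac_kernel s z \<le> 1 / (r powr p)"
        using 2 unfolding frac_kernel_def p_def d_def r_def by (intro divide_right_mono) (auto simp: trunc_sq_def)
      also have "\<dots> = r powr (- p)" by (simp add: powr_minus field_simps)
      also have "\<dots> \<le> (2 ^ j) powr (- p)" using j p by (intro powr_mono2') auto
      also have "\<dots> = A j" unfolding A_def by (simp add: powr_powr flip: powr_realpow) (simp add: mult.commute)
      finally have "ennreal (norm (trunc_sq z / frac_kernel s z)) \<le> ennreal (A j)"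
        by (intro ennreal_leI) simp
      also have "\<dots> \<le> G j z" using j unfolding G_def a_def r_def by (simp add: indicator_def)
      also note le_sum
      finally show ?thesis .
    next
      case 3
      have "1 \<le> 1 / r" using 3 by simp
      then obtain j where j: "2 ^ j \<le> 1 / r" "1 / r < 2 ^ Suc j" using dyadic_scale by blast
      have up: "r \<le> 2 powr (- real j)"
        using j 3 by (simp add: powr_minus powr_realpow field_simps)
      have lo: "2 powr (- real j - 1) \<le> r"
        using j 3 by (simp add: powr_minus powr_realpow powr_diff field_simps)
      have "trunc_sq z / frac_kernel s z \<le> r\<^sup>2 / (r powr p)"
        unfolding frac_kernel_def p_def d_def r_def by (intro divide_right_mono) (auto simp: trunc_sq_def)
      also have "\<dots> \<le> (2 powr (- real j))\<^sup>2 / ((2 powr (- real j - 1)) powr p)"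
        using 3 p up lo by (intro frac_le power_mono powr_mono2) auto
      also have "\<dots> = 2 powr (- real j + - real j - (- real j - 1) * p)"
        unfolding powr_powr by (simp only: powr_diff[of _ "_ + _"] powr_add power2_eq_square)
      also have "\<dots> = B j" unfolding B_def by (simp add: algebra_simps)
      finally have "ennreal (norm (trunc_sq z / frac_kernel s z)) \<le> ennreal (B j)"
        by (intro ennreal_leI) simp
      also have "\<dots> \<le> G j z"
      proof -
        have "r < 2 powr (1 - real j)"
          using up by (rule order.strict_trans1) (simp add: powr_less_cancel_iff)
        then show ?thesis unfolding G_def b_def r_def by (simp add: indicator_def)
      qed
      also note le_sum
      finally show ?thesis .
    qed
  qed
  have [measurable]: "a j \<in> sets borel" "b j \<in> sets borel" for j
    by (auto simp: a_def b_def)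
  have m[measurable]: "G j \<in> borel_measurable lborel" for j
    unfolding G_def[abs_def] by measurable
  define c where "c = unit_ball_vol d"
  have c: "c \<ge> 0" unfolding c_def d_def by simp
  define g where "g j = c * 2 powr d * (2 powr (- 2 * s)) ^ j
      + c * 2 powr (p + d) * (2 powr (2 * s - 2)) ^ j" for j :: nat
  have intG: "(\<integral>\<^sup>+z. G j z \<partial>lborel) = ennreal (g j)" for j
  proof -
    have e1: "A j * (c * (2 ^ Suc j) ^ CARD('n)) = c * 2 powr d * (2 powr (- 2 * s)) ^ j"
    proof -
      have "((2::real) ^ Suc j) ^ CARD('n) = 2 powr (real (Suc j) * d)"
        unfolding d_def by (simp add: powr_realpow[symmetric] powr_powr del: power_Suc)
      then have "A j * (c * (2 ^ Suc j) ^ CARD('n)) = c * 2 powr (- p * real j + real (Suc j) * d)"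
        unfolding A_def powr_add by simp
      also have "- p * real j + real (Suc j) * d = d + (- 2 * s) * real j"
        unfolding p_def by (simp add: algebra_simps)
      finally show ?thesis unfolding powr_add by (simp add: powr_powr flip: powr_realpow)
    qed
    have e2: "B j * (c * (2 powr (1 - real j)) ^ CARD('n)) = c * 2 powr (p + d) * (2 powr (2 * s - 2)) ^ j"
    proof -
      have "(2 powr (1 - real j)) ^ CARD('n) = 2 powr ((1 - real j) * d)"
        unfolding d_def by (simp add: powr_realpow[symmetric] powr_powr)
      then have "B j * (c * (2 powr (1 - real j)) ^ CARD('n))
          = c * 2 powr ((p - (2 - p) * real j) + (1 - real j) * d)"
        unfolding B_def powr_add by simp
      also have "(p - (2 - p) * real j) + (1 - real j) * d = p + d + (2 * s - 2) * real j"
        unfolding p_def by (simp add: algebra_simps)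
      finally show ?thesis unfolding powr_add by (simp add: powr_powr flip: powr_realpow)
    qed
    have "(\<integral>\<^sup>+z. G j z \<partial>lborel) = ennreal (A j) * emeasure lborel (a j) + ennreal (B j) * emeasure lborel (b j)"
      unfolding G_def by (subst nn_integral_add) (auto simp: nn_integral_cmult_indicator)
    also have "\<dots> = ennreal (A j * (c * (2 ^ Suc j) ^ CARD('n)) + B j * (c * (2 powr (1 - real j)) ^ CARD('n)))"
      using c unfolding a_def b_def c_def d_def A_def B_def
      by (subst (1 2) emeasure_ball) (auto simp: ennreal_mult ennreal_plus)
    finally show ?thesis by (simp only: e1 e2 g_def)
  qed
  have sg: "summable g"
    unfolding g_def
  proof (intro summable_add summable_mult summable_geometric)
    have "(2::real) powr (- 2 * s) < 2 powr 0" "(2::real) powr (2 * s - 2) < 2 powr 0"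
      using s by (intro powr_less_mono; simp)+
    then show "norm ((2::real) powr (- 2 * s)) < 1" "norm ((2::real) powr (2 * s - 2)) < 1" by auto
  qed
  have "(\<integral>\<^sup>+z. ennreal (norm (trunc_sq z / frac_kernel s (z::real ^ 'n))) \<partial>lborel) \<le> (\<integral>\<^sup>+z. (\<Sum>j. G j z) \<partial>lborel)"
    by (intro nn_integral_mono pw)
  also have "\<dots> = (\<Sum>j. ennreal (g j))"
    by (subst nn_integral_suminf) (auto simp: intG)
  also have "\<dots> < \<infinity>"
    using sg c by (subst suminf_ennreal2) (auto simp: g_def)
  finally show "(\<integral>\<^sup>+z. ennreal (norm (trunc_sq z / frac_kernel s (z::real ^ 'n))) \<partial>lborel) < \<infinity>" .
qed measurable

section \<open>The fractional Laplacian as an absolutely convergent integral\<close>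

definition second_diff :: "('a::real_vector \<Rightarrow> real) \<Rightarrow> 'a \<Rightarrow> 'a \<Rightarrow> real"
  where "second_diff v x z = 2 * v x - v (x + z) - v (x - z)"

text \<open>The fractional Laplacian without its normalising constant, with the principal value replaced by the
absolutely convergent integral of second differences.\<close>

definition frac_op :: "real \<Rightarrow> (real ^ 'n \<Rightarrow> real) \<Rightarrow> real ^ 'n \<Rightarrow> real"
  where "frac_op s v x = (LINT z|lborel. second_diff v x z / frac_kernel s z) / 2"

definition kernel_mass :: "'n::finite itself \<Rightarrow> real \<Rightarrow> real"
  where "kernel_mass _ s = (LINT z::real ^ 'n|lborel. trunc_sq z / frac_kernel s z) / 2"

lemma lborel_integral_shift:
  fixes f :: "'a::euclidean_space \<Rightarrow> real"
  assumes [measurable]: "f \<in> borel_measurable borel"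
  shows "(LINT z|lborel. f (c + z)) = (LINT z|lborel. f z)"
proof -
  have "(LINT z|lborel. f z) = (LINT z|distr lborel borel ((+) c). f z)"
    by (simp only: lborel_distr_plus)
  also have "\<dots> = (LINT z|lborel. f (c + z))" by (subst integral_distr) auto
  finally show ?thesis ..
qed

lemma lborel_integral_reflect:
  fixes f :: "'a::euclidean_space \<Rightarrow> real"
  assumes [measurable]: "f \<in> borel_measurable borel"
  shows "(LINT z|lborel. f (- z)) = (LINT z|lborel. f z)"
    and "integrable lborel (\<lambda>z. f (- z)) \<longleftrightarrow> integrable lborel f"
proof -
  have d: "distr lborel borel uminus = (lborel :: 'a measure)"
    by (subst lborel_affine[of "-1" 0]) (auto simp: density_1)
  have "(LINT z|lborel. f z) = (LINT z|distr lborel borel uminus. f z)"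
    by (simp only: d)
  also have "\<dots> = (LINT z|lborel. f (- z))" by (subst integral_distr) auto
  finally show "(LINT z|lborel. f (- z)) = (LINT z|lborel. f z)" ..
  have "integrable lborel f \<longleftrightarrow> integrable (distr lborel borel uminus) f"
    by (simp only: d)
  also have "\<dots> \<longleftrightarrow> integrable lborel (\<lambda>z. f (- z))" by (subst integrable_distr_eq) auto
  finally show "integrable lborel (\<lambda>z. f (- z)) \<longleftrightarrow> integrable lborel f" ..
qed

lemma second_diff_measurable [measurable]:
  fixes v :: "'a::euclidean_space \<Rightarrow> real"
  assumes [measurable]: "v \<in> borel_measurable borel"
  shows "second_diff v x \<in> borel_measurable borel"
  unfolding second_diff_def[abs_def] by measurable

lemma integrable_second_diff:
  fixes v :: "real ^ 'n \<Rightarrow> real"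
  assumes s: "0 < s" "s < 1" and [measurable]: "v \<in> borel_measurable borel"
    and b: "\<And>z. \<bar>second_diff v x z\<bar> \<le> N * trunc_sq z"
  shows "integrable lborel (\<lambda>z. second_diff v x z / frac_kernel s z)"
proof (rule Bochner_Integration.integrable_bound)
  show "integrable lborel (\<lambda>z. N * (trunc_sq z / frac_kernel s (z::real ^ 'n)))"
    by (intro integrable_mult_right kernel_integrable s)
  show "AE z in lborel. norm (second_diff v x z / frac_kernel s z) \<le> norm (N * (trunc_sq z / frac_kernel s z))"
  proof (rule AE_I2)
    fix z :: "real ^ 'n"
    have "\<bar>second_diff v x z\<bar> / frac_kernel s z \<le> (N * trunc_sq z) / frac_kernel s z"
      by (intro divide_right_mono b) simp
    then have "norm (second_diff v x z / frac_kernel s z) \<le> N * (trunc_sq z / frac_kernel s z)" by simp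
    also have "\<dots> \<le> norm (N * (trunc_sq z / frac_kernel s z))" unfolding real_norm_def by (rule abs_ge_self)
    finally show "norm (second_diff v x z / frac_kernel s z) \<le> norm (N * (trunc_sq z / frac_kernel s z))" .
  qed
qed measurable

text \<open>Used at maximum points, where one knows the sign of the second differences up to a controlled error.\<close>

lemma frac_op_lower_bound:
  fixes v w :: "real ^ 'n \<Rightarrow> real"
  assumes s: "0 < s" "s < 1" and [measurable]: "v \<in> borel_measurable borel"
    and b: "\<And>z. \<bar>second_diff v x z\<bar> \<le> N * trunc_sq z"
    and lo: "\<And>z. - B * trunc_sq z \<le> second_diff v x z"
  shows "- B * kernel_mass TYPE('n) s \<le> frac_op s v x"
proof -
  have "(LINT z|lborel. - B * (trunc_sq z / frac_kernel s (z::real ^ 'n))) \<le> (LINT z|lborel. second_diff v x z / frac_kernel s z)"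
  proof (intro integral_mono integrable_mult_right kernel_integrable s)
    show "integrable lborel (\<lambda>z. second_diff v x z / frac_kernel s z)"
      by (rule integrable_second_diff) (use s b in auto)
    show "- B * (trunc_sq z / frac_kernel s z) \<le> second_diff v x z / frac_kernel s z" for z :: "real ^ 'n"
      using divide_right_mono[OF lo[of z] frac_kernel_nonneg[of s z]] by simp
  qed
  then show ?thesis unfolding frac_op_def kernel_mass_def integral_mult_right_zero by simp
qed

lemma frac_op_abs_le:
  fixes v :: "real ^ 'n \<Rightarrow> real"
  assumes s: "0 < s" "s < 1" and [measurable]: "v \<in> borel_measurable borel"
    and b: "\<And>z. \<bar>second_diff v x z\<bar> \<le> N * trunc_sq z"
  shows "\<bar>frac_op s v x\<bar> \<le> N * kernel_mass TYPE('n) s"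
proof -
  have "\<bar>LINT z|lborel. second_diff v x z / frac_kernel s z\<bar> \<le> (LINT z|lborel. N * (trunc_sq z / frac_kernel s (z::real ^ 'n)))"
  proof (rule integral_abs_bound_integral)
    show "integrable lborel (\<lambda>z. second_diff v x z / frac_kernel s z)"
      by (rule integrable_second_diff) (use s b in auto)
    show "integrable lborel (\<lambda>z. N * (trunc_sq z / frac_kernel s (z::real ^ 'n)))"
      by (intro integrable_mult_right kernel_integrable s)
    show "\<bar>second_diff v x z / frac_kernel s z\<bar> \<le> N * (trunc_sq z / frac_kernel s z)" for z :: "real ^ 'n"
      using divide_right_mono[OF b[of z] frac_kernel_nonneg[of s z]] by simp
  qed
  then show ?thesis unfolding frac_op_def kernel_mass_def integral_mult_right_zero by simp
qed

lemma second_diff_diff: "second_diff (\<lambda>y. v y - w y) x z = second_diff v x z - second_diff w x z"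
  by (simp add: second_diff_def)

lemma second_diff_cmult: "second_diff (\<lambda>y. a * v y) x z = a * second_diff v x z"
  by (simp add: second_diff_def algebra_simps)

lemma frac_op_diff:
  fixes v w :: "real ^ 'n \<Rightarrow> real"
  assumes s: "0 < s" "s < 1" and "v \<in> borel_measurable borel" "w \<in> borel_measurable borel"
    and "\<And>z. \<bar>second_diff v x z\<bar> \<le> N * trunc_sq z" "\<And>z. \<bar>second_diff w x z\<bar> \<le> N' * trunc_sq z"
  shows "frac_op s (\<lambda>y. v y - w y) x = frac_op s v x - frac_op s w x"
proof -
  have "(LINT z|lborel. second_diff (\<lambda>y. v y - w y) x z / frac_kernel s z)
      = (LINT z|lborel. second_diff v x z / frac_kernel s z - second_diff w x z / frac_kernel s z)"
    by (simp only: second_diff_diff diff_divide_distrib)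
  also have "\<dots> = (LINT z|lborel. second_diff v x z / frac_kernel s z) - (LINT z|lborel. second_diff w x z / frac_kernel s z)"
    by (intro Bochner_Integration.integral_diff integrable_second_diff[OF s assms(3)] integrable_second_diff[OF s assms(4)])
       (fact assms)+
  finally show ?thesis unfolding frac_op_def by (simp add: diff_divide_distrib)
qed

lemma frac_op_cmult: "frac_op s (\<lambda>y. a * v y) x = a * frac_op s v x"
proof -
  have "(LINT z|lborel. a * second_diff v x z / frac_kernel s z) = (LINT z|lborel. a * (second_diff v x z / frac_kernel s z))"
    by simp
  then show ?thesis unfolding frac_op_def second_diff_cmult integral_mult_right_zero by simp
qed

lemma frac_op_minus: "frac_op s (\<lambda>y. - v y) x = - frac_op s v x"
  using frac_op_cmult[of s "-1" v x] by simp

text \<open>Boundedness takes care of large increments, so only increments of norm at most \<open>1\<close> need a quadratic bound.\<close>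

lemma second_diff_le_trunc_sq:
  assumes K: "\<And>y. \<bar>v y\<bar> \<le> K" and N: "\<And>z. norm z \<le> 1 \<Longrightarrow> \<bar>second_diff v x z\<bar> \<le> N * (norm z)\<^sup>2"
  shows "\<bar>second_diff v x z\<bar> \<le> max N (4 * K) * trunc_sq z"
proof (cases "norm z \<le> 1")
  case True
  then have "trunc_sq z = (norm z)\<^sup>2" using power_le_one[of "norm z" 2] by (simp add: trunc_sq_def)
  then show ?thesis using N[OF True]
    by (smt (verit) max.cobounded1 mult_right_mono zero_le_power2)
next
  case False
  then have c: "trunc_sq z = 1" by (simp add: trunc_sq_def min_def abs_square_le_1 power_le_one_iff)
  have "\<bar>second_diff v x z\<bar> \<le> 4 * K"
    using K[of x] K[of "x + z"] K[of "x - z"] unfolding second_diff_def by linarith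
  then show ?thesis using c by simp
qed

text \<open>Outside a ball the integrand of the principal value is integrable, so averaging it with its reflection
\<open>z \<mapsto> -z\<close> is legitimate and produces second differences; these are dominated by \<open>trunc_sq\<close>, and the
radius may be sent to \<open>0\<close>.\<close>

lemma frac_laplacian_eq_frac_op:
  fixes v :: "real ^ 'n \<Rightarrow> real"
  assumes s: "0 < s" "s < 1" and m[measurable]: "v \<in> borel_measurable borel"
    and K: "\<And>y. \<bar>v y\<bar> \<le> K"
    and b: "\<And>z. \<bar>second_diff v x z\<bar> \<le> N * trunc_sq z"
  shows "frac_laplacian s v x = frac_laplacian_const TYPE('n) s * frac_op s v x"
proof -
  define I where "I \<epsilon> = (LINT y:- ball x \<epsilon>|lebesgue. (v x - v y) / frac_kernel s (x - y))" for \<epsilon>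
  have I: "I \<epsilon> = (LINT z|lborel. indicator (- ball 0 \<epsilon>) z * (second_diff v x z / frac_kernel s z)) / 2"
    if "\<epsilon> > 0" for \<epsilon>
  proof -
    define T where "T z = indicator (- ball 0 \<epsilon>) z * ((v x - v (x + z)) / frac_kernel s z)" for z
    have [measurable]: "- ball x \<epsilon> \<in> sets borel" "- ball 0 \<epsilon> \<in> sets (borel :: (real^'n) measure)" by auto
    have mT[measurable]: "T \<in> borel_measurable borel" unfolding T_def[abs_def] by measurable
    define H where "H y = indicator (- ball x \<epsilon>) y *\<^sub>R ((v x - v y) / frac_kernel s (x - y))" for y
    have mH[measurable]: "H \<in> borel_measurable borel" unfolding H_def[abs_def] by measurable
    have HT: "H (x + z) = T z" for z
    proof -
      have "frac_kernel s (x - (x + z)) = frac_kernel s z"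
        using frac_kernel_minus[of s z] by simp
      moreover have "(x + z \<in> ball x \<epsilon>) = (z \<in> ball 0 \<epsilon>)" by (simp add: dist_norm)
      ultimately show ?thesis unfolding H_def T_def by (simp add: indicator_def)
    qed
    have "I \<epsilon> = (LINT y|lebesgue. H y)"
      unfolding I_def set_lebesgue_integral_def H_def ..
    also have "\<dots> = (LINT y|lborel. H y)" by (rule integral_completion) simp
    also have "\<dots> = (LINT z|lborel. H (x + z))" by (rule lborel_integral_shift[symmetric]) simp
    also have "\<dots> = (LINT z|lborel. T z)" by (simp only: HT)
    finally have 1: "I \<epsilon> = (LINT z|lborel. T z)" .
    have iT: "integrable lborel T"
    proof (rule Bochner_Integration.integrable_bound)
      show "integrable lborel (\<lambda>z. (2 * K / min 1 (\<epsilon>\<^sup>2)) * (trunc_sq z / frac_kernel s (z::real ^ 'n)))"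
        by (intro integrable_mult_right kernel_integrable s)
      show "AE z in lborel. norm (T z) \<le> norm ((2 * K / min 1 (\<epsilon>\<^sup>2)) * (trunc_sq z / frac_kernel s z))"
      proof (rule AE_I2)
        fix z :: "real ^ 'n"
        have K0: "0 \<le> K" using K[of x] by linarith
        show "norm (T z) \<le> norm ((2 * K / min 1 (\<epsilon>\<^sup>2)) * (trunc_sq z / frac_kernel s z))"
        proof (cases "z \<in> ball 0 \<epsilon>")
          case True
          then show ?thesis unfolding T_def by simp
        next
          case False
          then have "\<epsilon> \<le> norm z" by simp
          then have "\<epsilon>\<^sup>2 \<le> (norm z)\<^sup>2" using that by (intro power_mono) auto
          then have "min 1 (\<epsilon>\<^sup>2) \<le> trunc_sq z" unfolding trunc_sq_def by simp
          moreover have "0 < min 1 (\<epsilon>\<^sup>2)" using that by simp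
          ultimately have "1 \<le> trunc_sq z / min 1 (\<epsilon>\<^sup>2)" by simp
          moreover have "\<bar>v x - v (x + z)\<bar> \<le> 2 * K" using K[of x] K[of "x + z"] by linarith
          ultimately have "\<bar>v x - v (x + z)\<bar> * 1 \<le> (2 * K) * (trunc_sq z / min 1 (\<epsilon>\<^sup>2))"
            by (intro mult_mono) (use K0 in auto)
          then have "\<bar>v x - v (x + z)\<bar> / frac_kernel s z \<le> (2 * K) * (trunc_sq z / min 1 (\<epsilon>\<^sup>2)) / frac_kernel s z"
            by (intro divide_right_mono) auto
          moreover have "norm (T z) = \<bar>v x - v (x + z)\<bar> / frac_kernel s z"
            using False unfolding T_def by simp
          moreover have "norm ((2 * K / min 1 (\<epsilon>\<^sup>2)) * (trunc_sq z / frac_kernel s z))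
              = (2 * K) * (trunc_sq z / min 1 (\<epsilon>\<^sup>2)) / frac_kernel s z"
            using K0 by (simp add: abs_mult)
          ultimately show ?thesis by linarith
        qed
      qed
    qed measurable
    have "2 * I \<epsilon> = (LINT z|lborel. T z) + (LINT z|lborel. T (- z))"
      using 1 lborel_integral_reflect(1)[OF mT] by simp
    also have "\<dots> = (LINT z|lborel. T z + T (- z))"
      using iT lborel_integral_reflect(2)[OF mT] by (intro Bochner_Integration.integral_add[symmetric]) auto
    also have "\<dots> = (LINT z|lborel. indicator (- ball 0 \<epsilon>) z * (second_diff v x z / frac_kernel s z))"
      unfolding T_def second_diff_def by (intro Bochner_Integration.integral_cong) (auto simp: indicator_def add_divide_distrib diff_divide_distrib)
    finally show ?thesis by simp
  qed
  have "(I \<longlongrightarrow> frac_op s v x) (at_right 0)"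
  proof (rule tendsto_at_right_sequentially[of 0 1])
    fix S :: "nat \<Rightarrow> real"
    assume S: "\<And>n. 0 < S n" "S \<longlonglongrightarrow> 0"
    have "(\<lambda>n. LINT z|lborel. indicator (- ball 0 (S n)) z * (second_diff v x z / frac_kernel s z))
        \<longlonglongrightarrow> (LINT z|lborel. second_diff v x z / frac_kernel s z)"
    proof (rule integral_dominated_convergence)
      show "integrable lborel (\<lambda>z. \<bar>second_diff v x z / frac_kernel s z\<bar>)"
        by (intro integrable_abs integrable_second_diff[OF s m b])
      show "AE z in lborel. (\<lambda>n. indicator (- ball 0 (S n)) z * (second_diff v x z / frac_kernel s z))
          \<longlonglongrightarrow> second_diff v x z / frac_kernel s z"
      proof (rule AE_I2)
        fix z :: "real ^ 'n"
        show "(\<lambda>n. indicator (- ball 0 (S n)) z * (second_diff v x z / frac_kernel s z))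
          \<longlonglongrightarrow> second_diff v x z / frac_kernel s z"
        proof (cases "z = 0")
          case True
          then show ?thesis by (simp add: second_diff_def)
        next
          case False
          then have "eventually (\<lambda>n. S n < norm z) sequentially"
            using S(2) by (intro order_tendstoD) auto
          then have "eventually (\<lambda>n. indicator (- ball 0 (S n)) z * (second_diff v x z / frac_kernel s z)
              = second_diff v x z / frac_kernel s z) sequentially"
            by eventually_elim (simp add: indicator_def)
          then show ?thesis by (rule tendsto_eventually)
        qed
      qed
      show "AE z in lborel. norm (indicator (- ball 0 (S n)) z * (second_diff v x z / frac_kernel s z))
          \<le> \<bar>second_diff v x z / frac_kernel s z\<bar>" for n
        by (rule AE_I2) (simp add: indicator_def)
      have [measurable]: "- ball 0 (S n) \<in> sets (borel :: (real^'n) measure)" for n by auto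
      show "(\<lambda>z. indicator (- ball 0 (S n)) z * (second_diff v x z / frac_kernel s z)) \<in> borel_measurable lborel" for n
        by measurable
    qed measurable
    then have "(\<lambda>n. (LINT z|lborel. indicator (- ball 0 (S n)) z * (second_diff v x z / frac_kernel s z)) / 2)
        \<longlonglongrightarrow> frac_op s v x"
      unfolding frac_op_def by (intro tendsto_intros) auto
    then show "(\<lambda>n. I (S n)) \<longlonglongrightarrow> frac_op s v x" by (simp only: I[OF S(1)])
  qed simp
  then have "Lim (at_right 0) I = frac_op s v x"
    by (intro tendsto_Lim) (auto simp: trivial_limit_at_right_real)
  then show ?thesis unfolding frac_laplacian_def I_def[abs_def] by simp
qed

text \<open>If the defining integral diverged or vanished, the constant would be \<open>0\<close> by the conventions for
integrals and inverses, and the equation would lose its diffusion.  Convergence follows from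
\<open>1 - cos \<theta> \<le> min 2 (\<theta>\<^sup>2/2)\<close>.\<close>

lemma frac_laplacian_const_pos:
  assumes s: "0 < s" "s < 1"
  shows "frac_laplacian_const TYPE('n::finite) s > 0"
proof -
  define i where "i = (SOME i::'n. True)"
  define F where "F z = (1 - cos (2 * pi * z $ i)) / frac_kernel s z" for z :: "real ^ 'n"
  have [measurable]: "(\<lambda>z::real^'n. z $ i) \<in> borel_measurable borel"
    by (intro borel_measurable_continuous_onI continuous_intros)
  have mF[measurable]: "F \<in> borel_measurable borel" unfolding F_def[abs_def] by measurable
  have F0: "0 \<le> F z" for z unfolding F_def by (intro divide_nonneg_nonneg) auto
  have iF: "integrable lborel F"
  proof (rule Bochner_Integration.integrable_bound)
    show "integrable lborel (\<lambda>z. (2 + 2 * pi\<^sup>2) * (trunc_sq z / frac_kernel s (z::real ^ 'n)))"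
      by (intro integrable_mult_right kernel_integrable s)
    show "AE z in lborel. norm (F z) \<le> norm ((2 + 2 * pi\<^sup>2) * (trunc_sq z / frac_kernel s z))"
    proof (rule AE_I2)
      fix z :: "real ^ 'n"
      define \<theta> where "\<theta> = 2 * pi * z $ i"
      have "1 - cos \<theta> = 2 * (sin (\<theta> / 2))\<^sup>2"
        using cos_double_sin[of "\<theta> / 2"] by simp
      also have "(sin (\<theta> / 2))\<^sup>2 \<le> (\<theta> / 2)\<^sup>2"
        using abs_sin_x_le_abs_x[of "\<theta> / 2"] by (simp add: abs_le_square_iff[symmetric])
      also have "2 * (\<theta> / 2)\<^sup>2 = 2 * pi\<^sup>2 * (z $ i)\<^sup>2" unfolding \<theta>_def by (simp add: power2_eq_square)
      finally have 1: "1 - cos \<theta> \<le> 2 * pi\<^sup>2 * (z $ i)\<^sup>2" by simp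
      have "(z $ i)\<^sup>2 \<le> (norm z)\<^sup>2"
        using component_le_norm_cart[of z i] by (simp add: abs_le_square_iff[symmetric])
      then have "2 * pi\<^sup>2 * (z $ i)\<^sup>2 \<le> 2 * pi\<^sup>2 * (norm z)\<^sup>2" by (intro mult_left_mono) auto
      moreover have "2 * pi\<^sup>2 * (norm z)\<^sup>2 \<le> (2 + 2 * pi\<^sup>2) * (norm z)\<^sup>2"
        by (intro mult_right_mono) auto
      ultimately have 1: "1 - cos \<theta> \<le> (2 + 2 * pi\<^sup>2) * (norm z)\<^sup>2" using 1 by linarith
      have "0 \<le> 2 * pi\<^sup>2" by simp
      then have 2: "1 - cos \<theta> \<le> (2 + 2 * pi\<^sup>2) * 1" using cos_ge_minus_one[of \<theta>] unfolding mult_1_right by linarith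
      have "1 - cos \<theta> \<le> (2 + 2 * pi\<^sup>2) * trunc_sq z"
        using 1 2 unfolding trunc_sq_def min_def by auto
      then have "F z \<le> (2 + 2 * pi\<^sup>2) * trunc_sq z / frac_kernel s z"
        unfolding F_def \<theta>_def by (intro divide_right_mono) auto
      then show "norm (F z) \<le> norm ((2 + 2 * pi\<^sup>2) * (trunc_sq z / frac_kernel s z))"
        using F0[of z] by simp
    qed
  qed measurable
  have "(LINT z|lborel. F z) \<noteq> 0"
  proof
    assume "(LINT z|lborel. F z) = 0"
    then have ae: "AE z in lborel. F z = 0"
      using integral_nonneg_eq_0_iff_AE[OF iF] F0 by simp
    define U where "U = {z::real^'n. cos (2 * pi * z $ i) < 1}"
    have oU: "open U" unfolding U_def by (intro open_Collect_less continuous_intros)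
    have "F z \<noteq> 0" if "z \<in> U" for z
    proof -
      have "z \<noteq> 0" using that unfolding U_def by auto
      then have "frac_kernel s z > 0" unfolding frac_kernel_def by simp
      then show ?thesis using that unfolding F_def U_def by auto
    qed
    then have "AE z in lborel. z \<notin> U" using ae by (auto elim!: eventually_mono)
    then have "U \<in> null_sets lborel"
      using oU by (subst (asm) AE_iff_null_sets[symmetric]) auto
    then have "negligible U"
      by (simp add: negligible_iff_null_sets null_sets_completionI)
    moreover have "axis i (1/2) \<in> U" unfolding U_def by simp
    ultimately show False using oU open_not_negligible by blast
  qed
  moreover have "(LINT z|lborel. F z) \<ge> 0" by (intro Bochner_Integration.integral_nonneg F0)
  ultimately have "(LINT z|lborel. F z) > 0" by simp
  moreover have "(LINT z|lebesgue. F z) = (LINT z|lborel. F z)" by (rule integral_completion) simp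
  ultimately show ?thesis unfolding frac_laplacian_const_def F_def i_def by simp
qed

section \<open>A bump function and mollification\<close>

text \<open>A compactly supported \<open>C\<^sup>1\<^sup>,\<^sup>1\<close> function with explicit second differences; it serves both as mollifier and
as spatial cutoff.\<close>

definition bump :: "real \<Rightarrow> 'a::real_inner \<Rightarrow> real"
  where "bump r y = (max 0 (r\<^sup>2 - (norm y)\<^sup>2))\<^sup>2"

lemma bump_nonneg [simp]: "0 \<le> bump r y"
  by (simp add: bump_def)

lemma bump_le: "bump r y \<le> r ^ 4"
proof -
  have "bump r y \<le> (r\<^sup>2)\<^sup>2" unfolding bump_def by (intro power_mono) auto
  then show ?thesis by simp
qed

lemma bump_0 [simp]: "bump r 0 = r ^ 4"
  by (simp add: bump_def)

lemma bump_eq_0: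
  assumes "0 \<le> r" "r \<le> norm y"
  shows "bump r y = 0"
proof -
  have "r\<^sup>2 \<le> (norm y)\<^sup>2" using assms by (intro power_mono)
  then show ?thesis by (simp add: bump_def)
qed

lemma bump_pos:
  assumes "norm y < r"
  shows "0 < bump r y"
proof -
  have "(norm y)\<^sup>2 < r\<^sup>2" using assms by (intro power_strict_mono) auto
  then show ?thesis by (simp add: bump_def)
qed

lemma continuous_bump [continuous_intros]: "continuous_on S f \<Longrightarrow> continuous_on S (\<lambda>x. bump r (f x))"
  unfolding bump_def by (intro continuous_intros) auto

lemma bump_measurable [measurable]: "(bump r :: 'a::euclidean_space \<Rightarrow> real) \<in> borel_measurable borel"
  by (intro borel_measurable_continuous_onI continuous_intros)

text \<open>The function \<open>p \<mapsto> (max 0 p)\<^sup>2\<close> has second derivative at most \<open>2\<close>.\<close>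

lemma max_square_expansion:
  fixes p q :: real
  shows "\<bar>(max 0 q)\<^sup>2 - (max 0 p)\<^sup>2 - 2 * max 0 p * (q - p)\<bar> \<le> (q - p)\<^sup>2"
proof -
  consider "p \<ge> 0" "q \<ge> 0" | "p \<ge> 0" "q < 0" | "p < 0" "q \<ge> 0" | "p < 0" "q < 0" by linarith
  then show ?thesis
  proof cases
    case 1
    have "q\<^sup>2 - p\<^sup>2 - 2 * p * (q - p) = (q - p)\<^sup>2" by (simp add: power2_eq_square algebra_simps)
    then show ?thesis using 1 by simp
  next
    case 2
    then have "p * q \<le> 0" by (simp add: mult_nonneg_nonpos)
    moreover have "0 \<le> q * q" "0 \<le> p * p" by simp_all
    moreover have "(max 0 q)\<^sup>2 - (max 0 p)\<^sup>2 - 2 * max 0 p * (q - p) = p * p - 2 * (p * q)"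
      using 2 by (simp add: power2_eq_square algebra_simps)
    moreover have "(q - p)\<^sup>2 = q * q - 2 * (p * q) + p * p" by (simp add: power2_eq_square algebra_simps)
    ultimately show ?thesis by linarith
  next
    case 3
    then have "p * q \<le> 0" by (simp add: mult_nonpos_nonneg)
    moreover have "0 \<le> q * q" "0 \<le> p * p" by simp_all
    moreover have "(max 0 q)\<^sup>2 - (max 0 p)\<^sup>2 - 2 * max 0 p * (q - p) = q * q"
      using 3 by (simp add: power2_eq_square)
    moreover have "(q - p)\<^sup>2 = q * q - 2 * (p * q) + p * p" by (simp add: power2_eq_square algebra_simps)
    ultimately show ?thesis by linarith
  next
    case 4
    then show ?thesis by simp
  qed
qed

text \<open>Apply the expansion above to \<open>p = r\<^sup>2 - |x|\<^sup>2\<close> and \<open>q = r\<^sup>2 - |x \<plusminus> z|\<^sup>2\<close>: the linear terms in \<open>z\<close> cancel in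
the second difference.  Far from the support there is nothing to estimate, so \<open>|x|\<close> may be taken
to be at most \<open>r + 1\<close>.\<close>

lemma second_diff_bump_bound:
  fixes x z :: "'a::real_inner"
  assumes r: "0 < r"
  shows "\<bar>second_diff (bump r) x z\<bar> \<le> max (4 * r\<^sup>2 + 2 + 8 * (r + 1)\<^sup>2) (4 * r ^ 4) * trunc_sq z"
proof (rule second_diff_le_trunc_sq)
  show "\<bar>bump r y\<bar> \<le> r ^ 4" for y :: 'a using bump_le[of r y] by simp
  fix z :: 'a
  assume z: "norm z \<le> 1"
  show "\<bar>second_diff (bump r) x z\<bar> \<le> (4 * r\<^sup>2 + 2 + 8 * (r + 1)\<^sup>2) * (norm z)\<^sup>2"
  proof (cases "norm x \<le> r + 1")
    case True
    define p where "p = r\<^sup>2 - (norm x)\<^sup>2"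
    define P where "P = max 0 p"
    define i where "i = inner x z"
    define M where "M = (norm z)\<^sup>2"
    have M: "0 \<le> M" "M \<le> 1" using z unfolding M_def by (auto simp: power_le_one)
    have e1: "r\<^sup>2 - (norm (x + z))\<^sup>2 = p - M - 2 * i"
      unfolding p_def M_def i_def by (simp add: power2_norm_eq_inner inner_simps inner_commute)
    have e2: "r\<^sup>2 - (norm (x - z))\<^sup>2 = p - M + 2 * i"
      unfolding p_def M_def i_def by (simp add: power2_norm_eq_inner inner_simps inner_commute)
    have 1: "\<bar>bump r (x + z) - P\<^sup>2 - 2 * P * (- M - 2 * i)\<bar> \<le> (- M - 2 * i)\<^sup>2"
      using max_square_expansion[of "p - M - 2 * i" p] unfolding bump_def e1 P_def by simp
    have 2: "\<bar>bump r (x - z) - P\<^sup>2 - 2 * P * (- M + 2 * i)\<bar> \<le> (- M + 2 * i)\<^sup>2"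
      using max_square_expansion[of "p - M + 2 * i" p] unfolding bump_def e2 P_def by simp
    have "2 * bump r x = 2 * P\<^sup>2" unfolding bump_def P_def p_def by simp
    then have 3: "\<bar>second_diff (bump r) x z - 4 * (P * M)\<bar> \<le> (- M - 2 * i)\<^sup>2 + (- M + 2 * i)\<^sup>2"
      using 1 2 unfolding second_diff_def by (simp add: algebra_simps)
    have 4: "(- M - 2 * i)\<^sup>2 + (- M + 2 * i)\<^sup>2 = 2 * (M * M) + 8 * i\<^sup>2"
      by (simp add: power2_eq_square algebra_simps)
    have "i\<^sup>2 \<le> (norm x)\<^sup>2 * M"
      using Cauchy_Schwarz_ineq2[of x z] unfolding i_def M_def
      by (metis abs_ge_zero power2_abs power_mono power_mult_distrib)
    moreover have "(norm x)\<^sup>2 * M \<le> (r + 1)\<^sup>2 * M"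
      using True M by (intro mult_right_mono power_mono) auto
    moreover have "M * M \<le> 1 * M" using M by (intro mult_right_mono) auto
    moreover have "0 \<le> P * M" "P * M \<le> r\<^sup>2 * M"
      using M unfolding P_def p_def by (auto intro!: mult_right_mono)
    ultimately have "\<bar>second_diff (bump r) x z\<bar> \<le> 4 * (r\<^sup>2 * M) + 2 * M + 8 * ((r + 1)\<^sup>2 * M)"
      using 3 4 by linarith
    then show ?thesis unfolding M_def by (simp add: algebra_simps)
  next
    case False
    have "norm x - norm z \<le> norm (x + z)" "norm x - norm z \<le> norm (x - z)"
      using norm_diff_ineq[of x z] norm_triangle_ineq2[of x z] by auto
    then have "bump r x = 0" "bump r (x + z) = 0" "bump r (x - z) = 0"
      using False z r by (auto intro!: bump_eq_0)
    then show ?thesis by (simp add: second_diff_def)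
  qed
qed

lemma second_diff_bump_support:
  assumes "0 < r" "norm z \<le> 1" "r + 1 < norm x"
  shows "second_diff (bump r) x z = 0"
proof -
  have "norm x - norm z \<le> norm (x + z)" "norm x - norm z \<le> norm (x - z)"
    using norm_diff_ineq[of x z] norm_triangle_ineq2[of x z] by auto
  then have "bump r x = 0" "bump r (x + z) = 0" "bump r (x - z) = 0"
    using assms by (auto intro!: bump_eq_0)
  then show ?thesis by (simp add: second_diff_def)
qed

lemma integrable_indicator_cball [simp]:
  "integrable lborel (\<lambda>y::'a::euclidean_space. c * indicator (cball a R) y :: real)"
  using emeasure_lborel_cball_finite[of a R] by (intro integrable_mult_right integrable_real_indicator) auto

lemma integrable_bump:
  assumes "0 < r"
  shows "integrable lborel (bump r :: 'a::euclidean_space \<Rightarrow> real)"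
proof (rule Bochner_Integration.integrable_bound)
  show "integrable lborel (\<lambda>y::'a. r ^ 4 * indicator (cball 0 r) y :: real)"
    by (rule integrable_indicator_cball)
  show "AE y in lborel. norm (bump r y) \<le> norm (r ^ 4 * indicator (cball (0::'a) r) y :: real)"
    using assms by (intro AE_I2) (auto simp: indicator_def bump_le bump_eq_0)
qed simp

lemma integral_bump_pos:
  assumes "0 < r"
  shows "0 < (LINT y|lborel. bump r (y::'a::euclidean_space))"
proof -
  have "(LINT y|lborel. bump r (y::'a)) \<noteq> 0"
  proof
    assume "(LINT y|lborel. bump r (y::'a)) = 0"
    then have "AE y in lborel. bump r (y::'a) = 0"
      using integral_nonneg_eq_0_iff_AE[OF integrable_bump[OF assms, where 'a='a]] by simp
    then have "AE y in lborel. (y::'a) \<notin> ball 0 r"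
      by eventually_elim (use bump_pos[where 'a='a and r=r] in force)
    then have "ball (0::'a) r \<in> null_sets lborel"
      by (subst (asm) AE_iff_null_sets[symmetric]) auto
    then have "negligible (ball (0::'a) r)"
      by (simp add: negligible_iff_null_sets null_sets_completionI)
    then show False using open_not_negligible[of "ball (0::'a) r"] assms by auto
  qed
  moreover have "0 \<le> (LINT y|lborel. bump r (y::'a))" by (intro Bochner_Integration.integral_nonneg) simp
  ultimately show ?thesis by linarith
qed

definition moll_kernel :: "real \<Rightarrow> 'a::euclidean_space \<Rightarrow> real"
  where "moll_kernel r y = bump r y / (LINT y|lborel. bump r (y::'a))"

definition moll :: "real \<Rightarrow> ('a::euclidean_space \<Rightarrow> real) \<Rightarrow> 'a \<Rightarrow> real"
  where "moll r v x = (LINT y|lborel. moll_kernel r y * v (x + y))"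

lemma moll_kernel_nonneg [simp]: "0 < r \<Longrightarrow> 0 \<le> moll_kernel r y"
  using integral_bump_pos[of r] by (simp add: moll_kernel_def)

lemma moll_kernel_eq_0: "0 < r \<Longrightarrow> r \<le> norm y \<Longrightarrow> moll_kernel r y = 0"
  by (simp add: moll_kernel_def bump_eq_0)

lemma moll_kernel_measurable [measurable]: "(moll_kernel r :: 'a::euclidean_space \<Rightarrow> real) \<in> borel_measurable borel"
  unfolding moll_kernel_def[abs_def] by measurable

lemma continuous_moll_kernel [continuous_intros]:
  "continuous_on S f \<Longrightarrow> continuous_on S (\<lambda>x. moll_kernel r (f x))"
  unfolding moll_kernel_def by (cases "(LINT y|lborel. bump r (y::'b)) = 0") (auto intro!: continuous_intros)

lemma integrable_moll_kernel: "0 < r \<Longrightarrow> integrable lborel (moll_kernel r :: 'a::euclidean_space \<Rightarrow> real)"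
  unfolding moll_kernel_def[abs_def] by (intro integrable_divide_zero integrable_bump)

lemma integral_moll_kernel: "0 < r \<Longrightarrow> (LINT y|lborel. moll_kernel r (y::'a::euclidean_space)) = 1"
  using integral_bump_pos[of r, where 'a='a] unfolding moll_kernel_def by simp

lemma integrable_moll_kernel_mult:
  fixes g :: "'a::euclidean_space \<Rightarrow> real"
  assumes r: "0 < r" and [measurable]: "g \<in> borel_measurable borel"
    and K: "\<And>y. norm y \<le> r \<Longrightarrow> \<bar>g y\<bar> \<le> K"
  shows "integrable lborel (\<lambda>y. moll_kernel r y * g y)"
proof (rule Bochner_Integration.integrable_bound)
  show "integrable lborel (\<lambda>y::'a. K * moll_kernel r y)" using integrable_moll_kernel[OF r, where 'a='a] by simp
  have "\<bar>moll_kernel r y * g y\<bar> \<le> K * moll_kernel r y" for y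
  proof (cases "norm y \<le> r")
    case True
    then show ?thesis using K[OF True] r
      by (simp add: abs_mult mult.commute mult_right_mono)
  next
    case False
    then show ?thesis using moll_kernel_eq_0[OF r, of y] by simp
  qed
  then show "AE y in lborel. norm (moll_kernel r y * g y) \<le> norm (K * moll_kernel r y)"
    by (intro AE_I2) (metis abs_ge_self order_trans real_norm_def)
qed measurable

lemma moll_kernel_mult_le:
  fixes g :: "'a::euclidean_space \<Rightarrow> real"
  assumes r: "0 < r" and [measurable]: "g \<in> borel_measurable borel"
    and K: "\<And>y. norm y \<le> r \<Longrightarrow> \<bar>g y\<bar> \<le> K"
  shows "\<bar>LINT y|lborel. moll_kernel r y * g y\<bar> \<le> K"
proof -
  have "\<bar>LINT y|lborel. moll_kernel r y * g y\<bar> \<le> (LINT y|lborel. K * moll_kernel r (y::'a))"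
  proof (rule integral_abs_bound_integral)
    show "integrable lborel (\<lambda>y. moll_kernel r y * g y)" by (rule integrable_moll_kernel_mult[OF r _ K]) auto
    show "integrable lborel (\<lambda>y::'a. K * moll_kernel r y)" using integrable_moll_kernel[OF r, where 'a='a] by simp
    show "\<bar>moll_kernel r y * g y\<bar> \<le> K * moll_kernel r y" for y
    proof (cases "norm y \<le> r")
      case True
      then show ?thesis using K[OF True] r
        by (simp add: abs_mult mult.commute mult_right_mono)
    next
      case False
      then show ?thesis using moll_kernel_eq_0[OF r, of y] by simp
    qed
  qed
  also have "\<dots> = K" using integral_moll_kernel[OF r, where 'a='a] by simp
  finally show ?thesis .
qed

lemma moll_abs_le:
  fixes v :: "'a::euclidean_space \<Rightarrow> real"
  assumes r: "0 < r" and [measurable]: "v \<in> borel_measurable borel" and K: "\<And>y. \<bar>v y\<bar> \<le> K"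
  shows "\<bar>moll r v x\<bar> \<le> K"
  unfolding moll_def by (rule moll_kernel_mult_le[OF r]) (auto simp: K)

lemma moll_near:
  fixes v :: "'a::euclidean_space \<Rightarrow> real"
  assumes r: "0 < r" and [measurable]: "v \<in> borel_measurable borel"
    and e: "\<And>y. norm y \<le> r \<Longrightarrow> \<bar>v (x + y) - a\<bar> \<le> e"
  shows "\<bar>moll r v x - a\<bar> \<le> e"
proof -
  have b: "\<bar>v (x + y)\<bar> \<le> \<bar>a\<bar> + e" if "norm y \<le> r" for y using e[OF that] by linarith
  have i: "integrable lborel (\<lambda>y. moll_kernel r y * v (x + y))"
    by (rule integrable_moll_kernel_mult[OF r _ b]) auto
  have "(LINT y|lborel. moll_kernel r y * (v (x + y) - a)) = (LINT y|lborel. moll_kernel r y * v (x + y) - a * moll_kernel r y)"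
    by (simp add: algebra_simps)
  also have "\<dots> = moll r v x - a"
    using i integrable_moll_kernel[OF r, where 'a='a] integral_moll_kernel[OF r, where 'a='a] unfolding moll_def by simp
  finally have "moll r v x - a = (LINT y|lborel. moll_kernel r y * (v (x + y) - a))" ..
  then show ?thesis using moll_kernel_mult_le[OF r, of "\<lambda>y. v (x + y) - a" e] e by simp
qed

lemma moll_shift:
  fixes v :: "'a::euclidean_space \<Rightarrow> real"
  assumes [measurable]: "v \<in> borel_measurable borel"
  shows "moll r v x = (LINT y|lborel. moll_kernel r (y - x) * v y)"
proof -
  have "(LINT y|lborel. moll_kernel r (y - x) * v y) = (LINT y|lborel. moll_kernel r (x + y - x) * v (x + y))"
    by (rule lborel_integral_shift[symmetric]) measurable
  then show ?thesis unfolding moll_def by simp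
qed

text \<open>Pointwise convergence of bounded functions suffices, even when the base point moves, because the
kernel can carry the translation.  This turns separate continuity into joint continuity.\<close>

lemma moll_tendsto:
  fixes v :: "'a::euclidean_space \<Rightarrow> real"
  assumes r: "0 < r" and m[measurable]: "v \<in> borel_measurable borel" "\<And>n. V n \<in> borel_measurable borel"
    and K: "\<And>n y. \<bar>V n y\<bar> \<le> K" and X: "X \<longlonglongrightarrow> x" and lim: "\<And>y. (\<lambda>n. V n y) \<longlonglongrightarrow> v y"
  shows "(\<lambda>n. moll r (V n) (X n)) \<longlonglongrightarrow> moll r v x"
proof -
  obtain R where R: "\<And>n. norm (X n) \<le> R"
    using convergent_imp_bounded[OF X] unfolding bounded_iff by auto
  define c where "c = r ^ 4 / (LINT y|lborel. bump r (y::'a))"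
  have K0: "0 \<le> K" using K[of 0 0] by linarith
  have c: "0 \<le> moll_kernel r w" "moll_kernel r w \<le> c" for w :: 'a
    using bump_le[of r w] integral_bump_pos[OF r, where 'a='a] r
    unfolding c_def moll_kernel_def by (auto intro: divide_right_mono)
  have "(\<lambda>n. LINT y|lborel. moll_kernel r (y - X n) * V n y) \<longlonglongrightarrow> (LINT y|lborel. moll_kernel r (y - x) * v y)"
  proof (rule integral_dominated_convergence)
    show "integrable lborel (\<lambda>y::'a. (c * K) * indicator (cball 0 (R + r)) y :: real)"
      by (rule integrable_indicator_cball)
    show "AE y in lborel. (\<lambda>n. moll_kernel r (y - X n) * V n y) \<longlonglongrightarrow> moll_kernel r (y - x) * v y"
    proof (intro AE_I2 tendsto_mult lim)
      fix y :: 'a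
      have "continuous_on UNIV (\<lambda>w. moll_kernel r (y - w))" by (intro continuous_intros)
      then show "(\<lambda>n. moll_kernel r (y - X n)) \<longlonglongrightarrow> moll_kernel r (y - x)"
        using X by (simp add: continuous_on_eq_continuous_at isCont_tendsto_compose[of x "\<lambda>w. moll_kernel r (y - w)"])
    qed
    show "AE y in lborel. norm (moll_kernel r (y - X n) * V n y) \<le> (c * K) * indicator (cball 0 (R + r)) y" for n
    proof (rule AE_I2)
      fix y :: 'a
      show "norm (moll_kernel r (y - X n) * V n y) \<le> (c * K) * indicator (cball 0 (R + r)) y"
      proof (cases "norm y \<le> R + r")
        case True
        have "moll_kernel r (y - X n) * \<bar>V n y\<bar> \<le> c * K"
          using c[of "y - X n"] K0 K[of n y] by (intro mult_mono) auto
        then show ?thesis using True c(1)[of "y - X n"] by (simp add: abs_mult indicator_def)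
      next
        case False
        then have "r \<le> norm (y - X n)" using norm_triangle_ineq2[of y "X n"] R[of n] by linarith
        then show ?thesis using moll_kernel_eq_0[OF r, of "y - X n"] False by simp
      qed
    qed
  qed measurable
  then show ?thesis by (simp only: moll_shift m)
qed

lemma continuous_on_moll:
  fixes v :: "'a::euclidean_space \<Rightarrow> real"
  assumes r: "0 < r" and m: "v \<in> borel_measurable borel" and K: "\<And>y. \<bar>v y\<bar> \<le> K"
  shows "continuous_on UNIV (moll r v)"
  by (intro continuous_on_sequentiallyI moll_tendsto[OF r m m K]) auto

lemma second_diff_moll:
  fixes v :: "'a::euclidean_space \<Rightarrow> real"
  assumes r: "0 < r" and m[measurable]: "v \<in> borel_measurable borel" and K: "\<And>y. \<bar>v y\<bar> \<le> K"
  shows "second_diff (moll r v) x z = (LINT y|lborel. moll_kernel r y * second_diff v (x + y) z)"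
proof -
  have i: "integrable lborel (\<lambda>y. moll_kernel r y * v (w + y))" for w
    by (rule integrable_moll_kernel_mult[OF r _ K]) auto
  have "(LINT y|lborel. moll_kernel r y * second_diff v (x + y) z)
      = (LINT y|lborel. 2 * (moll_kernel r y * v (x + y)) - moll_kernel r y * v (x + z + y) - moll_kernel r y * v (x - z + y))"
    unfolding second_diff_def by (simp add: algebra_simps)
  also have "\<dots> = second_diff (moll r v) x z"
    using i[of x] i[of "x + z"] i[of "x - z"] unfolding second_diff_def moll_def by simp
  finally show ?thesis ..
qed

lemma second_diff_moll_le:
  fixes v :: "'a::euclidean_space \<Rightarrow> real"
  assumes r: "0 < r" and m[measurable]: "v \<in> borel_measurable borel" and K: "\<And>y. \<bar>v y\<bar> \<le> K"
    and N: "\<And>y. norm y \<le> r \<Longrightarrow> \<bar>second_diff v (x + y) z\<bar> \<le> N"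
  shows "\<bar>second_diff (moll r v) x z\<bar> \<le> N"
  unfolding second_diff_moll[OF r m K]
  by (rule moll_kernel_mult_le[OF r _ N]) (auto simp: second_diff_def[abs_def])

text \<open>The second difference is put on the kernel, so the bound depends on the mollified function only through
its supremum.\<close>

lemma second_diff_moll_uniform:
  fixes K :: real
  assumes r: "0 < r"
  obtains C where "\<And>v x z. v \<in> borel_measurable borel \<Longrightarrow> (\<And>y. \<bar>v (y::'a::euclidean_space)\<bar> \<le> K)
    \<Longrightarrow> \<bar>second_diff (moll r v) x z\<bar> \<le> C * trunc_sq z"
proof -
  define c where "c = (LINT y|lborel. bump r (y::'a))"
  have c: "c > 0" using integral_bump_pos[OF r] unfolding c_def .
  define C0 where "C0 = max (4 * r\<^sup>2 + 2 + 8 * (r + 1)\<^sup>2) (4 * r ^ 4)"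
  have C0: "0 \<le> C0" unfolding C0_def by (simp add: le_max_iff_disj)
  define m where "m = measure lborel (cball (0::'a) (r + 1))"
  define N where "N = C0 / c * K * m"
  have "\<bar>second_diff (moll r v) x z\<bar> \<le> max N (4 * K) * trunc_sq z"
    if mv[measurable]: "v \<in> borel_measurable borel" and K: "\<And>y. \<bar>v (y::'a)\<bar> \<le> K" for v x z
  proof (rule second_diff_le_trunc_sq)
    show "\<bar>moll r v y\<bar> \<le> K" for y by (rule moll_abs_le[OF r mv K])
    fix z :: 'a
    assume z: "norm z \<le> 1"
    have K0: "0 \<le> K" using K[of 0] by linarith
    define D where "D y = second_diff (moll_kernel r) (y - x) z * v y" for y
    have [measurable]: "(\<lambda>y. second_diff (moll_kernel r) (y - x) z) \<in> borel_measurable borel"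
      unfolding second_diff_def by measurable
    have sm: "second_diff (moll_kernel r) w z = second_diff (bump r) w z / c" for w :: 'a
      unfolding second_diff_def moll_kernel_def c_def by (simp add: diff_divide_distrib)
    have bound: "\<bar>D y\<bar> \<le> (C0 / c * K * (norm z)\<^sup>2) * indicator (cball x (r + 1)) y" for y
    proof (cases "norm (y - x) \<le> r + 1")
      case True
      have "\<bar>second_diff (bump r) (y - x) z\<bar> \<le> C0 * trunc_sq z"
        using second_diff_bump_bound[OF r] unfolding C0_def by blast
      also have "\<dots> \<le> C0 * (norm z)\<^sup>2" using C0 by (intro mult_left_mono trunc_sq_le) auto
      finally have "\<bar>second_diff (moll_kernel r) (y - x) z\<bar> \<le> C0 * (norm z)\<^sup>2 / c"
        unfolding sm using c by (simp add: divide_right_mono)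
      then have "\<bar>second_diff (moll_kernel r) (y - x) z\<bar> * \<bar>v y\<bar> \<le> C0 * (norm z)\<^sup>2 / c * K"
        using K[of y] C0 c by (intro mult_mono) auto
      then show ?thesis using True unfolding D_def
        by (simp add: abs_mult indicator_def dist_norm norm_minus_commute mult_ac)
    next
      case False
      then show ?thesis using second_diff_bump_support[OF r z] K0 C0 c unfolding D_def sm
        by (auto simp: indicator_def)
    qed
    have i: "integrable lborel (\<lambda>y. moll_kernel r (y - w) * v y)" for w
    proof -
      have "integrable (distr lborel borel ((+) w)) (\<lambda>y. moll_kernel r (y - w) * v y)
          \<longleftrightarrow> integrable lborel (\<lambda>y. moll_kernel r (w + y - w) * v (w + y))"
        by (rule integrable_distr_eq) measurable
      moreover have "integrable lborel (\<lambda>y. moll_kernel r y * v (w + y))"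
        by (rule integrable_moll_kernel_mult[OF r _ K]) auto
      ultimately show ?thesis unfolding lborel_distr_plus by simp
    qed
    have "(LINT y|lborel. D y)
      = (LINT y|lborel. 2 * (moll_kernel r (y - x) * v y) - moll_kernel r (y - (x + z)) * v y - moll_kernel r (y - (x - z)) * v y)"
      unfolding D_def second_diff_def by (simp add: algebra_simps)
    also have "\<dots> = second_diff (moll r v) x z"
      using i[of x] i[of "x + z"] i[of "x - z"] unfolding second_diff_def by (simp add: moll_shift)
    finally have "\<bar>second_diff (moll r v) x z\<bar> = \<bar>LINT y|lborel. D y\<bar>" by simp
    also have "\<dots> \<le> (LINT y|lborel. (C0 / c * K * (norm z)\<^sup>2) * indicator (cball x (r + 1)) y)"
    proof (rule integral_abs_bound_integral)
      show "integrable lborel (\<lambda>y. (C0 / c * K * (norm z)\<^sup>2) * indicator (cball x (r + 1)) y :: real)"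
        by (rule integrable_indicator_cball)
      then show "integrable lborel D"
      proof (rule Bochner_Integration.integrable_bound)
        show "D \<in> borel_measurable lborel" unfolding D_def[abs_def] by measurable
        show "AE y in lborel. norm (D y) \<le> norm ((C0 / c * K * (norm z)\<^sup>2) * indicator (cball x (r + 1)) y :: real)"
          by (intro AE_I2) (metis bound abs_ge_self order_trans real_norm_def)
      qed
    qed (rule bound)
    also have "\<dots> = (C0 / c * K * (norm z)\<^sup>2) * measure lborel (cball x (r + 1))"
      by simp
    also have "measure lborel (cball x (r + 1)) = m"
      unfolding m_def using r by (simp add: content_cball)
    finally show "\<bar>second_diff (moll r v) x z\<bar> \<le> N * (norm z)\<^sup>2"
      unfolding N_def by (simp add: mult_ac)
  qed
  then show ?thesis by (rule that)
qed

text \<open>Fubini; the local bound on the second differences of \<open>v\<close> makes the double integral converge absolutely.\<close>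

lemma frac_op_moll:
  fixes v :: "real ^ 'n \<Rightarrow> real"
  assumes s: "0 < s" "s < 1" and r: "0 < r" and cont: "continuous_on UNIV v" and K: "\<And>y. \<bar>v y\<bar> \<le> K"
    and N: "\<And>y z. norm y \<le> r \<Longrightarrow> \<bar>second_diff v (x + y) z\<bar> \<le> N * trunc_sq z"
  shows "frac_op s (moll r v) x = (LINT y|lborel. moll_kernel r y * frac_op s v (x + y))"
proof -
  have m[measurable]: "v \<in> borel_measurable borel" by (rule borel_measurable_continuous_onI[OF cont])
  define F where "F z y = moll_kernel r y * (second_diff v (x + y) z / frac_kernel s z)" for z y :: "real ^ 'n"
  have [measurable]: "(\<lambda>p::(real^'n)\<times>(real^'n). second_diff v (x + snd p) (fst p)) \<in> borel_measurable (borel \<Otimes>\<^sub>M borel)"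
    unfolding second_diff_def by measurable
  have mF: "case_prod F \<in> borel_measurable (lborel \<Otimes>\<^sub>M lborel)"
    unfolding F_def[abs_def] case_prod_beta' by measurable
  have F0: "\<bar>F z y\<bar> \<le> moll_kernel r y * (N * (trunc_sq z / frac_kernel s z))" for z y
  proof (cases "norm y \<le> r")
    case True
    have "\<bar>second_diff v (x + y) z\<bar> / frac_kernel s z \<le> N * trunc_sq z / frac_kernel s z"
      by (intro divide_right_mono N True) simp
    then have "moll_kernel r y * (\<bar>second_diff v (x + y) z\<bar> / frac_kernel s z) \<le> moll_kernel r y * (N * trunc_sq z / frac_kernel s z)"
      using r by (intro mult_left_mono) auto
    then show ?thesis unfolding F_def using r by (simp add: abs_mult)
  next
    case False
    then show ?thesis unfolding F_def using moll_kernel_eq_0[OF r, of y] by simp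
  qed
  have iF: "integrable (lborel \<Otimes>\<^sub>M lborel) (case_prod F)"
  proof (rule Bochner_Integration.integrable_bound[OF _ mF])
    have "integrable (lborel \<Otimes>\<^sub>M lborel) (\<lambda>p::(real^'n)\<times>(real^'n).
        (N * (trunc_sq (fst p) / frac_kernel s (fst p))) * moll_kernel r (snd p))"
    proof (rule lborel_pair.Fubini_integrable)
      have "(\<lambda>z. LINT y|lborel. norm (N * (trunc_sq z / frac_kernel s z) * moll_kernel r (y::real^'n)))
          = (\<lambda>z::real^'n. \<bar>N\<bar> * (trunc_sq z / frac_kernel s z))"
        using r integral_moll_kernel[OF r, where 'a="real^'n"] by (simp add: abs_mult)
      then show "integrable lborel (\<lambda>z::real^'n. LINT y|lborel. norm (N * (trunc_sq (fst (z, y)) / frac_kernel s (fst (z, y)))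
          * moll_kernel r (snd (z, y::real^'n))))"
        using kernel_integrable[OF s, where 'n='n] by (simp only: fst_conv snd_conv) (intro integrable_mult_right)
      show "AE z in lborel. integrable lborel (\<lambda>y. N * (trunc_sq (fst (z, y)) / frac_kernel s (fst (z, y)))
          * moll_kernel r (snd (z::real^'n, y::real^'n)))"
        unfolding fst_conv snd_conv by (intro AE_I2 integrable_mult_right integrable_moll_kernel[OF r])
    qed measurable
    then show "integrable (lborel \<Otimes>\<^sub>M lborel) (\<lambda>p::(real^'n)\<times>(real^'n).
        (N * (trunc_sq (fst p) / frac_kernel s (fst p))) * moll_kernel r (snd p))" .
    show "AE p in lborel \<Otimes>\<^sub>M lborel. norm (case_prod F p)
        \<le> norm ((N * (trunc_sq (fst p) / frac_kernel s (fst p))) * moll_kernel r (snd p))"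
    proof (rule AE_I2)
      fix p :: "(real ^ 'n) \<times> (real ^ 'n)"
      have "norm (case_prod F p) \<le> moll_kernel r (snd p) * (N * (trunc_sq (fst p) / frac_kernel s (fst p)))"
        using F0[of "fst p" "snd p"] by (simp add: case_prod_beta)
      also have "\<dots> = (N * (trunc_sq (fst p) / frac_kernel s (fst p))) * moll_kernel r (snd p)" by (rule mult.commute)
      also have "\<dots> \<le> norm \<dots>" unfolding real_norm_def by (rule abs_ge_self)
      finally show "norm (case_prod F p) \<le> norm ((N * (trunc_sq (fst p) / frac_kernel s (fst p))) * moll_kernel r (snd p))" .
    qed
  qed
  have "moll_kernel r y * frac_op s v (x + y) = (LINT z|lborel. F z y) / 2" for y
    unfolding F_def integral_mult_right_zero frac_op_def by simp
  then have "(LINT y|lborel. moll_kernel r y * frac_op s v (x + y)) = (LINT y|lborel. (LINT z|lborel. F z y)) / 2"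
    by (simp only: integral_divide_zero)
  also have "(LINT y|lborel. (LINT z|lborel. F z y)) = (LINT z|lborel. (LINT y|lborel. F z y))"
    by (rule lborel_pair.Fubini_integral[OF iF])
  also have "\<dots> = (LINT z|lborel. second_diff (moll r v) x z / frac_kernel s z)"
  proof (rule Bochner_Integration.integral_cong[OF refl])
    fix z :: "real ^ 'n"
    have "(LINT y|lborel. F z y) = (LINT y|lborel. (moll_kernel r y * second_diff v (x + y) z) / frac_kernel s z)"
      unfolding F_def by simp
    also have "\<dots> = second_diff (moll r v) x z / frac_kernel s z"
      unfolding second_diff_moll[OF r m K] by (rule integral_divide_zero)
    finally show "(LINT y|lborel. F z y) = second_diff (moll r v) x z / frac_kernel s z" .
  qed
  finally show ?thesis unfolding frac_op_def by simp
qed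

section \<open>Continuous induction and one-sided derivatives\<close>

text \<open>Induction along a closed set of times: the set of good points is closed under increasing limits by the
one-sided semicontinuity of \<open>p\<close>, and every good point short of the end can be passed.  Only this
weak form of continuity is available in the backward argument, and gaps in the set are needed to
jump over intervals on which other estimates hold.\<close>

lemma continuous_induction_le:
  fixes p :: "real \<Rightarrow> real"
  assumes S: "closed S" "a \<in> S" "b \<in> S" "S \<subseteq> {a..b}"
    and left: "\<And>\<tau> e. \<tau> \<in> S \<Longrightarrow> 0 < e \<Longrightarrow> \<exists>\<eta>>0. \<forall>\<sigma>\<in>S. \<tau> - \<eta> < \<sigma> \<and> \<sigma> \<le> \<tau> \<longrightarrow> p \<tau> \<le> p \<sigma> + e"
    and step: "\<And>\<tau>. \<tau> \<in> S \<Longrightarrow> \<tau> < b \<Longrightarrow> p \<tau> \<le> p a + B * (\<tau> - a) \<Longrightarrow>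
      \<exists>\<sigma>\<in>S. \<tau> < \<sigma> \<and> p \<sigma> \<le> p \<tau> + B * (\<sigma> - \<tau>)"
  shows "p b \<le> p a + B * (b - a)"
proof -
  define T where "T = {\<tau>\<in>S. p \<tau> \<le> p a + B * (\<tau> - a)}"
  define m where "m = Sup T"
  have aT: "a \<in> T" using S unfolding T_def by simp
  have bdd: "bdd_above T" by (rule bdd_above_mono[of "{a..b}"]) (use S(4) in \<open>auto simp: T_def\<close>)
  have TS: "T \<subseteq> S" unfolding T_def by auto
  have "m \<in> closure T" unfolding m_def by (rule closure_contains_Sup) (use aT bdd in auto)
  then have mS: "m \<in> S" using S(1) TS closure_minimal by blast
  have mT: "m \<in> T"
  proof -
    have "p m \<le> p a + B * (m - a) + e" if e: "0 < e" for e
    proof -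
      obtain \<eta> where \<eta>: "\<eta> > 0" "\<And>\<sigma>. \<sigma> \<in> S \<Longrightarrow> m - \<eta> < \<sigma> \<Longrightarrow> \<sigma> \<le> m \<Longrightarrow> p m \<le> p \<sigma> + e / 2"
        using left[OF mS, of "e / 2"] e by auto
      define d where "d = min \<eta> (e / (2 * (\<bar>B\<bar> + 1)))"
      have d: "d > 0" unfolding d_def using \<eta> e by auto
      obtain \<sigma> where \<sigma>: "\<sigma> \<in> T" "m - d < \<sigma>"
        using less_cSupE[of "m - d" T] d aT unfolding m_def by auto
      have le: "\<sigma> \<le> m" unfolding m_def by (rule cSup_upper[OF \<sigma>(1) bdd])
      have "p m \<le> p \<sigma> + e / 2" using \<eta>(2)[of \<sigma>] \<sigma> le TS unfolding d_def by auto
      moreover have "p \<sigma> \<le> p a + B * (\<sigma> - a)" using \<sigma> unfolding T_def by auto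
      moreover have "B * (\<sigma> - a) \<le> B * (m - a) + e / 2"
      proof -
        have "B * (\<sigma> - m) \<le> \<bar>B\<bar> * (m - \<sigma>)" using le
          by (metis abs_ge_minus_self diff_ge_0_iff_ge minus_diff_eq minus_mult_commute mult_right_mono)
        also have "\<dots> \<le> (\<bar>B\<bar> + 1) * (e / (2 * (\<bar>B\<bar> + 1)))"
          using \<sigma>(2) le e unfolding d_def by (intro mult_mono) auto
        also have "\<dots> = e / 2" by (simp add: field_simps)
        finally show ?thesis by (simp add: algebra_simps)
      qed
      ultimately show ?thesis by linarith
    qed
    then have "p m \<le> p a + B * (m - a)" by (rule field_le_epsilon)
    then show ?thesis using mS unfolding T_def by simp
  qed
  have "m = b"
  proof (rule ccontr)
    assume "m \<noteq> b"
    then have "m < b" using mS S(4) by force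
    then obtain \<sigma> where \<sigma>: "\<sigma> \<in> S" "m < \<sigma>" "p \<sigma> \<le> p m + B * (\<sigma> - m)"
      using step[OF mS] mT unfolding T_def by auto
    have "p \<sigma> \<le> p a + B * (\<sigma> - a)" using \<sigma>(3) mT unfolding T_def by (simp add: algebra_simps)
    then have "\<sigma> \<in> T" using \<sigma>(1) unfolding T_def by simp
    then have "\<sigma> \<le> m" unfolding m_def by (rule cSup_upper[OF _ bdd])
    then show False using \<sigma>(2) by simp
  qed
  then show ?thesis using mT unfolding T_def by simp
qed

lemma right_derivative_step:
  fixes p :: "real \<Rightarrow> real"
  assumes "(p has_real_derivative D) (at_right t)" "D < B"
  shows "\<exists>\<eta>>0. \<forall>h. 0 \<le> h \<and> h < \<eta> \<longrightarrow> p (t + h) \<le> p t + B * h"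
proof -
  have "((\<lambda>y. (p y - p t) / (y - t)) \<longlongrightarrow> D) (at_right t)"
    using assms(1) by (simp add: has_field_derivative_iff)
  then have "eventually (\<lambda>y. (p y - p t) / (y - t) < B) (at_right t)"
    using assms(2) by (rule order_tendstoD)
  then obtain \<eta> where \<eta>: "\<eta> > 0" "\<And>y. y \<in> {t<..} \<Longrightarrow> y \<noteq> t \<Longrightarrow> dist y t < \<eta> \<Longrightarrow> (p y - p t) / (y - t) < B"
    unfolding eventually_at by blast
  have "p (t + h) \<le> p t + B * h" if "0 \<le> h" "h < \<eta>" for h
  proof (cases "h = 0")
    case False
    then have "(p (t + h) - p t) / h < B" using \<eta>(2)[of "t + h"] that by (simp add: dist_real_def)
    then show ?thesis using False that by (simp add: field_simps)
  qed simp
  then show ?thesis using \<eta>(1) by blast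
qed

lemma continuous_left_bound:
  fixes p :: "real \<Rightarrow> real"
  assumes "continuous_on S p" "\<tau> \<in> S" "0 < e"
  shows "\<exists>\<eta>>0. \<forall>\<sigma>\<in>S. \<tau> - \<eta> < \<sigma> \<and> \<sigma> \<le> \<tau> \<longrightarrow> p \<tau> \<le> p \<sigma> + e"
proof -
  obtain \<eta> where "\<eta> > 0" "\<forall>\<sigma>\<in>S. dist \<sigma> \<tau> < \<eta> \<longrightarrow> dist (p \<sigma>) (p \<tau>) < e"
    using assms unfolding continuous_on_iff by blast
  then show ?thesis by (intro exI[of _ \<eta>]) (force simp: dist_real_def)
qed

lemma right_derivative_upper:
  fixes p :: "real \<Rightarrow> real"
  assumes ab: "a \<le> b" and cont: "continuous_on {a..b} p"
    and der: "\<And>t. a \<le> t \<Longrightarrow> t < b \<Longrightarrow> \<exists>D<B. (p has_real_derivative D) (at_right t)"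
  shows "p b \<le> p a + B * (b - a)"
proof (rule continuous_induction_le[of "{a..b}"])
  show "\<exists>\<eta>>0. \<forall>\<sigma>\<in>{a..b}. \<tau> - \<eta> < \<sigma> \<and> \<sigma> \<le> \<tau> \<longrightarrow> p \<tau> \<le> p \<sigma> + e" if "\<tau> \<in> {a..b}" "0 < e" for \<tau> e
    by (rule continuous_left_bound[OF cont that])
  fix t assume t: "t \<in> {a..b}" "t < b"
  then obtain D where "D < B" "(p has_real_derivative D) (at_right t)" using der by force
  then obtain \<eta> where \<eta>: "\<eta> > 0" "\<And>h. 0 \<le> h \<Longrightarrow> h < \<eta> \<Longrightarrow> p (t + h) \<le> p t + B * h"
    using right_derivative_step by blast
  show "\<exists>\<sigma>\<in>{a..b}. t < \<sigma> \<and> p \<sigma> \<le> p t + B * (\<sigma> - t)"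
    using \<eta>(2)[of "min (\<eta> / 2) (b - t)"] \<eta>(1) t by (intro bexI[of _ "t + min (\<eta> / 2) (b - t)"]) auto
qed (use ab in auto)

text \<open>On a short interval the increments of \<open>p\<close> and \<open>-p\<close> are controlled by the extreme values of the right
derivative, which are close to \<open>q t0\<close>.\<close>

lemma derivative_from_right:
  fixes p q :: "real \<Rightarrow> real"
  assumes J: "open J" "is_interval J" and cont: "continuous_on J p" "continuous_on J q"
    and der: "\<And>t. t \<in> J \<Longrightarrow> (p has_real_derivative q t) (at_right t)" and t0: "t0 \<in> J"
  shows "(p has_real_derivative q t0) (at t0)"
proof -
  have inc: "\<bar>p b - p a - q t0 * (b - a)\<bar> \<le> e * (b - a)"
    if ab: "a \<le> b" "{a..b} \<subseteq> J" and e: "\<And>t. t \<in> {a..b} \<Longrightarrow> \<bar>q t - q t0\<bar> < e" for a b e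
  proof -
    have "p b \<le> p a + (q t0 + e) * (b - a)"
    proof (rule right_derivative_upper[OF ab(1)])
      show "\<exists>D<q t0 + e. (p has_real_derivative D) (at_right t)" if "a \<le> t" "t < b" for t
      proof -
        have "t \<in> {a..b}" "t \<in> J" using ab(2) that by auto
        then show ?thesis using der[of t] e[of t] by (intro exI[of _ "q t"]) auto
      qed
    qed (use cont ab continuous_on_subset in blast)
    moreover have "- p b \<le> - p a + (- q t0 + e) * (b - a)"
    proof (rule right_derivative_upper[OF ab(1), of "\<lambda>t. - p t"])
      show "\<exists>D<(- q t0 + e). ((\<lambda>t. - p t) has_real_derivative D) (at_right t)" if "a \<le> t" "t < b" for t
      proof -
        have "t \<in> {a..b}" "t \<in> J" using ab(2) that by auto
        then show ?thesis using der[of t] e[of t] by (intro exI[of _ "- q t"]) (auto intro!: derivative_eq_intros)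
      qed
    qed (use cont ab continuous_on_subset in \<open>blast intro: continuous_on_minus\<close>)
    ultimately show ?thesis by (simp add: algebra_simps abs_le_iff)
  qed
  have "((\<lambda>y. (p y - p t0) / (y - t0)) \<longlongrightarrow> q t0) (at t0)"
  proof (rule tendstoI)
    fix e :: real assume e: "0 < e"
    obtain d1 where d1: "d1 > 0" "\<And>t. t \<in> J \<Longrightarrow> dist t t0 < d1 \<Longrightarrow> dist (q t) (q t0) < e / 2"
      using cont(2) t0 e unfolding continuous_on_iff by (metis half_gt_zero)
    obtain d2 where d2: "d2 > 0" "ball t0 d2 \<subseteq> J" using J(1) t0 open_contains_ball by blast
    define d where "d = min d1 d2"
    have "dist ((p y - p t0) / (y - t0)) (q t0) < e" if y: "y \<noteq> t0" "dist y t0 < d" for y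
    proof -
      have near: "t \<in> J \<and> \<bar>q t - q t0\<bar> < e / 2" if "t \<in> {min y t0..max y t0}" for t
      proof -
        have "dist t t0 < d" using that y unfolding dist_real_def by auto
        then show ?thesis using d1(2)[of t] d2(2) unfolding d_def by (auto simp: dist_real_def dist_commute subset_iff)
      qed
      have "\<bar>p (max y t0) - p (min y t0) - q t0 * (max y t0 - min y t0)\<bar> \<le> e / 2 * (max y t0 - min y t0)"
        using near by (intro inc) auto
      then have "\<bar>p y - p t0 - q t0 * (y - t0)\<bar> \<le> e / 2 * \<bar>y - t0\<bar>"
        by (cases "y \<le> t0") (auto simp: algebra_simps abs_if split: if_splits)
      also have "\<dots> < e * \<bar>y - t0\<bar>" using e y by simp
      finally have "\<bar>p y - p t0 - q t0 * (y - t0)\<bar> / \<bar>y - t0\<bar> < e" using y by (simp add: divide_less_eq)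
      moreover have "(p y - p t0) / (y - t0) - q t0 = (p y - p t0 - q t0 * (y - t0)) / (y - t0)"
        using y by (simp add: field_simps)
      ultimately show ?thesis by (simp add: dist_real_def abs_divide)
    qed
    then show "eventually (\<lambda>y. dist ((p y - p t0) / (y - t0)) (q t0) < e) (at t0)"
      unfolding eventually_at using d1(1) d2(1) by (intro exI[of _ d]) (auto simp: d_def)
  qed
  then show ?thesis by (simp add: has_field_derivative_iff)
qed

section \<open>A localised barrier\<close>

text \<open>The constant of \<open>second_diff_bump_bound\<close>, rescaled for a bump of height \<open>1\<close>.\<close>

definition bump_bound :: "real \<Rightarrow> real"
  where "bump_bound r = max (4 * r\<^sup>2 + 2 + 8 * (r + 1)\<^sup>2) (4 * r ^ 4) / r ^ 4"

text \<open>The cutoff of the barriers: it vanishes at the centre and equals \<open>1\<close> outside the ball.\<close>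

definition hole :: "real \<Rightarrow> 'a::real_inner \<Rightarrow> 'a \<Rightarrow> real"
  where "hole r x0 x = 1 - bump r (x - x0) / r ^ 4"

lemma bump_bound_nonneg: "0 < r \<Longrightarrow> 0 \<le> bump_bound r"
  unfolding bump_bound_def by (intro divide_nonneg_nonneg) (auto simp: le_max_iff_disj)

lemma hole_center [simp]: "0 < r \<Longrightarrow> hole r x0 x0 = 0"
  by (simp add: hole_def)

lemma hole_nonneg: "0 < r \<Longrightarrow> 0 \<le> hole r x0 x"
  using bump_le[of r "x - x0"] by (simp add: hole_def divide_le_eq)

lemma hole_outside: "0 < r \<Longrightarrow> r \<le> norm (x - x0) \<Longrightarrow> hole r x0 x = 1"
  by (simp add: hole_def bump_eq_0)

lemma continuous_hole [continuous_intros]: "continuous_on S g \<Longrightarrow> continuous_on S (\<lambda>x. hole r x0 (g x))"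
  unfolding hole_def by (cases "r = 0") (auto intro!: continuous_intros)

lemma second_diff_hole_le:
  assumes r: "0 < r"
  shows "\<bar>second_diff (hole r x0) x z\<bar> \<le> bump_bound r * trunc_sq z"
proof -
  have "second_diff (hole r x0) x z = - second_diff (bump r) (x - x0) z / r ^ 4"
    unfolding second_diff_def hole_def by (simp add: add_divide_distrib diff_divide_distrib algebra_simps)
  then have "\<bar>second_diff (hole r x0) x z\<bar> = \<bar>second_diff (bump r) (x - x0) z\<bar> / r ^ 4" by simp
  also have "\<dots> \<le> (max (4 * r\<^sup>2 + 2 + 8 * (r + 1)\<^sup>2) (4 * r ^ 4) * trunc_sq z) / r ^ 4"
    by (intro divide_right_mono second_diff_bump_bound r) simp
  finally show ?thesis unfolding bump_bound_def by simp
qed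

lemma kernel_mass_nonneg: "0 \<le> kernel_mass TYPE('n::finite) s"
  unfolding kernel_mass_def by (intro divide_nonneg_nonneg Bochner_Integration.integral_nonneg) auto

text \<open>Comparison with \<open>W(\<cdot>,a) + 2K\<cdot>hole + C(t-a)\<close>.  Outside the ball the multiple \<open>2K\<close> of the cutoff makes
the comparison trivial, whatever \<open>W\<close> does there; so a violation would be a global spatial maximum of
the difference, attained inside by joint continuity.  There the nonlocal term is bounded by the
second differences of the initial value and of the cutoff, which gives a time derivative below \<open>C\<close>,
while at a maximum of the difference it would have to be at least \<open>C\<close>.\<close>

lemma barrier_estimate:
  fixes W :: "real ^ 'n \<Rightarrow> real \<Rightarrow> real"
  assumes s: "0 < s" "s < 1" and c: "0 \<le> c" and r: "0 < r" and ab: "a < b"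
    and cont: "continuous_on (cball x0 r \<times> {a..b}) (\<lambda>p. W (fst p) (snd p))"
    and meas: "\<And>t. (\<lambda>x. W x t) \<in> borel_measurable borel"
    and K: "\<And>x t. \<bar>W x t\<bar> \<le> K"
    and der: "\<And>x t. x \<in> ball x0 r \<Longrightarrow> a < t \<Longrightarrow> t \<le> b \<Longrightarrow>
      (W x has_real_derivative F x t - c * frac_op s (\<lambda>y. W y t) x) (at t)"
    and F: "\<And>x t. F x t \<le> M"
    and sd: "\<And>x t. \<exists>N. \<forall>z. \<bar>second_diff (\<lambda>y. W y t) x z\<bar> \<le> N * trunc_sq z"
    and ini: "\<And>x z. x \<in> ball x0 r \<Longrightarrow> \<bar>second_diff (\<lambda>y. W y a) x z\<bar> \<le> N * trunc_sq z"
    and C: "0 \<le> C" "M + c * ((N + 2 * K * bump_bound r) * kernel_mass TYPE('n) s) < C"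
  shows "W x0 b \<le> W x0 a + C * (b - a)"
proof (rule ccontr)
  assume neg: "\<not> ?thesis"
  (* The hypothetical violation: Z is positive at (x0, b). *)
  define Z where "Z x t = W x t - W x a - 2 * K * hole r x0 x - C * (t - a)" for x t
  have K0: "0 \<le> K" using K[of x0 a] by linarith
  have "continuous_on (cball x0 r \<times> {a..b}) (\<lambda>p. W (fst p) a)"
  proof -
    have "continuous_on (cball x0 r \<times> {a..b}) (\<lambda>p. (fst p, a))" by (intro continuous_intros)
    moreover have "(\<lambda>p. (fst p, a)) ` (cball x0 r \<times> {a..b}) \<subseteq> cball x0 r \<times> {a..b}" using ab by auto
    ultimately have "continuous_on (cball x0 r \<times> {a..b}) (\<lambda>p. W (fst (fst p, a)) (snd (fst p, a)))"
      by (rule continuous_on_compose2[OF cont])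
    then show ?thesis by simp
  qed
  then have "continuous_on (cball x0 r \<times> {a..b}) (\<lambda>p. Z (fst p) (snd p))"
    unfolding Z_def by (intro continuous_intros cont)
  moreover have "compact (cball x0 r \<times> {a..b})" by (intro compact_Times) auto
  moreover have "(x0, b) \<in> cball x0 r \<times> {a..b}" using r ab by auto
  ultimately have "\<exists>p1\<in>cball x0 r \<times> {a..b}. \<forall>p\<in>cball x0 r \<times> {a..b}. Z (fst p) (snd p) \<le> Z (fst p1) (snd p1)"
    by (intro continuous_attains_sup) blast+
  then obtain p1 where p1: "p1 \<in> cball x0 r \<times> {a..b}"
    "\<forall>p\<in>cball x0 r \<times> {a..b}. Z (fst p) (snd p) \<le> Z (fst p1) (snd p1)"
    by blast
  define x1 t1 where "x1 = fst p1" and "t1 = snd p1"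
  have mem: "x1 \<in> cball x0 r" "a \<le> t1" "t1 \<le> b" using p1(1) unfolding x1_def t1_def by auto
  have mx: "Z x t \<le> Z x1 t1" if "x \<in> cball x0 r" "a \<le> t" "t \<le> b" for x t
    using p1(2)[rule_format, of "(x, t)"] that unfolding x1_def t1_def by simp
  have "0 < Z x0 b" using neg r unfolding Z_def by simp
  also have "\<dots> \<le> Z x1 t1" using mx[of x0 b] r ab by simp
  finally have pos: "0 < Z x1 t1" .
  have out: "Z x t \<le> 0" if "r \<le> norm (x - x0)" "a \<le> t" for x t
  proof -
    have "W x t - W x a \<le> 2 * K" using K[of x t] K[of x a] by linarith
    moreover have "0 \<le> C * (t - a)" using C(1) that(2) by simp
    ultimately show ?thesis unfolding Z_def hole_outside[OF r that(1)] by simp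
  qed
  have glob: "Z x t1 \<le> Z x1 t1" for x
  proof (cases "norm (x - x0) \<le> r")
    case True
    then show ?thesis using mx[of x t1] mem by (simp add: dist_norm norm_minus_commute)
  next
    case False
    then show ?thesis using out[of x t1] mem pos by simp
  qed
  have x1: "x1 \<in> ball x0 r"
  proof (rule ccontr)
    assume "x1 \<notin> ball x0 r"
    then have "r \<le> norm (x1 - x0)" by (simp add: dist_norm norm_minus_commute)
    then show False using out[of x1 t1] pos mem by simp
  qed
  have t1: "a < t1"
  proof (rule ccontr)
    assume "\<not> a < t1"
    then have "t1 = a" using mem by simp
    moreover have "0 \<le> 2 * K * hole r x0 x1" using hole_nonneg[OF r, of x0 x1] K0 by simp
    ultimately show False using pos unfolding Z_def by simp
  qed
  have low: "- (N + 2 * K * bump_bound r) * trunc_sq z \<le> second_diff (\<lambda>y. W y t1) x1 z" for z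
  proof -
    have "0 \<le> second_diff (\<lambda>y. Z y t1) x1 z" using glob[of "x1 + z"] glob[of "x1 - z"] unfolding second_diff_def by linarith
    also have "\<dots> = second_diff (\<lambda>y. W y t1) x1 z - second_diff (\<lambda>y. W y a) x1 z - 2 * K * second_diff (hole r x0) x1 z"
      unfolding second_diff_def Z_def by (simp add: algebra_simps)
    finally have 1: "second_diff (\<lambda>y. W y a) x1 z + 2 * K * second_diff (hole r x0) x1 z \<le> second_diff (\<lambda>y. W y t1) x1 z" by simp
    have 2: "- (N * trunc_sq z) \<le> second_diff (\<lambda>y. W y a) x1 z" using ini[OF x1, of z] by linarith
    have "2 * K * (- (bump_bound r * trunc_sq z)) \<le> 2 * K * second_diff (hole r x0) x1 z"
      using second_diff_hole_le[OF r, of x0 x1 z] K0 by (intro mult_left_mono) auto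
    with 1 2 show ?thesis by (simp add: algebra_simps)
  qed
  obtain N1 where N1: "\<And>z. \<bar>second_diff (\<lambda>y. W y t1) x1 z\<bar> \<le> N1 * trunc_sq z" using sd by blast
  have "- (N + 2 * K * bump_bound r) * kernel_mass TYPE('n) s \<le> frac_op s (\<lambda>y. W y t1) x1"
    by (rule frac_op_lower_bound[OF s meas N1 low])
  then have "c * (- (N + 2 * K * bump_bound r) * kernel_mass TYPE('n) s) \<le> c * frac_op s (\<lambda>y. W y t1) x1"
    using c by (rule mult_left_mono)
  then have D: "F x1 t1 - c * frac_op s (\<lambda>y. W y t1) x1 < C" using F[of x1 t1] C(2) by (simp add: algebra_simps)
  have "((\<lambda>t. W x1 a + 2 * K * hole r x0 x1 + C * (t - a)) has_real_derivative C) (at t1)"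
    by (auto intro!: derivative_eq_intros)
  from DERIV_diff[OF der[OF x1 t1 mem(3)] this]
  have dZ: "(Z x1 has_real_derivative (F x1 t1 - c * frac_op s (\<lambda>y. W y t1) x1) - C) (at t1)"
    unfolding Z_def[abs_def] by (simp add: diff_diff_eq add.assoc)
  have "\<exists>d>0. \<forall>h>0. h < d \<longrightarrow> Z x1 t1 < Z x1 (t1 - h)"
    by (rule DERIV_neg_dec_left[OF dZ]) (use D in simp)
  then obtain d where d: "d > 0" "\<And>h. 0 < h \<Longrightarrow> h < d \<Longrightarrow> Z x1 t1 < Z x1 (t1 - h)" by blast
  define h where "h = min (d / 2) (t1 - a)"
  have "0 < h" "h < d" "a \<le> t1 - h" using d(1) t1 unfolding h_def by auto
  then show False using d(2)[of h] mx[of x1 "t1 - h"] mem by simp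
qed

section \<open>Regularity in time\<close>

text \<open>The equation with all regularity in the form in which it is used: second differences, quadratically
bounded on balls with constants depending on the time, and differentiability in \<open>t\<close> for each \<open>x\<close>.\<close>

locale frac_flow =
  fixes s c K :: real and f :: "real \<Rightarrow> real" and u :: "real ^ 'n \<Rightarrow> real \<Rightarrow> real"
  assumes s: "0 < s" "s < 1" and c: "0 < c"
    and range: "\<And>x t. 0 \<le> u x t" "\<And>x t. u x t \<le> K"
    and cont_x: "\<And>t. continuous_on UNIV (\<lambda>x. u x t)"
    and reg: "\<And>t R. \<exists>N. \<forall>x z. norm x \<le> R \<longrightarrow> \<bar>second_diff (\<lambda>y. u y t) x z\<bar> \<le> N * trunc_sq z"
    and evol: "\<And>x t. (u x has_real_derivative f (u x t) - c * frac_op s (\<lambda>y. u y t) x) (at t)"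
    and f_cont: "continuous_on {0..K} f"
    and f_mono: "\<And>a b. 0 \<le> a \<Longrightarrow> a \<le> b \<Longrightarrow> b \<le> K \<Longrightarrow> f b \<le> f a"
begin

definition f_bound :: real where "f_bound = max \<bar>f 0\<bar> \<bar>f K\<bar>"

definition u_moll :: "real \<Rightarrow> real ^ 'n \<Rightarrow> real \<Rightarrow> real"
  where "u_moll r x t = moll r (\<lambda>y. u y t) x"

text \<open>The right-hand side of the mollified equation.  It is continuous in \<open>t\<close> because the second
differences fall on the mollifier, uniformly in \<open>t\<close>.\<close>

definition moll_rhs :: "real \<Rightarrow> real ^ 'n \<Rightarrow> real \<Rightarrow> real"
  where "moll_rhs r x t = moll r (\<lambda>y. f (u y t)) x - c * frac_op s (\<lambda>y. u_moll r y t) x"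

text \<open>The balls over which \<open>u\<close> is averaged lie in the ball of radius \<open>R\<close> about the origin; the strict inequality makes room for estimates that degenerate at distance \<open>R\<close>.\<close>

definition moll_evolves :: "real \<Rightarrow> real \<Rightarrow> bool"
  where "moll_evolves R t \<longleftrightarrow> (\<forall>r x. 0 < r \<and> norm x + r < R \<longrightarrow> (u_moll r x has_real_derivative moll_rhs r x t) (at t))"

definition regular :: "real \<Rightarrow> real \<Rightarrow> real \<Rightarrow> bool"
  where "regular N R t \<longleftrightarrow> (\<forall>x z. norm x \<le> R \<longrightarrow> \<bar>second_diff (\<lambda>y. u y t) x z\<bar> \<le> N * trunc_sq z)"

lemma abs_u_le: "\<bar>u x t\<bar> \<le> K"
  using range[of x t] by simp

lemma K_nonneg: "0 \<le> K"
  using abs_u_le[of 0 0] by linarith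

lemma u_measurable [measurable]: "(\<lambda>x. u x t) \<in> borel_measurable borel"
  by (rule borel_measurable_continuous_onI[OF cont_x])

lemma cont_t: "continuous_on S (u x)"
  using evol by (meson DERIV_isCont continuous_at_imp_continuous_on)

lemma cont_f_u: "continuous_on S (\<lambda>x. f (u x t))" "continuous_on T (\<lambda>t. f (u x t))"
  using range
  by (auto intro!: continuous_on_compose2[OF f_cont] continuous_on_subset[OF cont_x] continuous_on_subset[OF cont_t])

lemma f_u_measurable [measurable]: "(\<lambda>x. f (u x t)) \<in> borel_measurable borel"
  by (rule borel_measurable_continuous_onI[OF cont_f_u(1)])

lemma abs_f_u_le: "\<bar>f (u x t)\<bar> \<le> f_bound"
proof -
  have "f K \<le> f (u x t)" "f (u x t) \<le> f 0" using range[of _ t] by (auto intro!: f_mono)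
  then show ?thesis unfolding f_bound_def by linarith
qed

lemma f_bound_nonneg: "0 \<le> f_bound"
  unfolding f_bound_def by simp

lemma u_lim: "X \<longlonglongrightarrow> t \<Longrightarrow> (\<lambda>n. u x (X n)) \<longlonglongrightarrow> u x t"
  by (rule continuous_on_tendsto_compose[OF cont_t[of UNIV]]) auto

lemma f_u_lim: "X \<longlonglongrightarrow> t \<Longrightarrow> (\<lambda>n. f (u x (X n))) \<longlonglongrightarrow> f (u x t)"
  by (rule continuous_on_tendsto_compose[OF cont_f_u(2)[of UNIV]]) auto

lemma regular_ex: "\<exists>N. regular N R t"
  using reg unfolding regular_def by blast

lemma regularD: "regular N R t \<Longrightarrow> norm x \<le> R \<Longrightarrow> \<bar>second_diff (\<lambda>y. u y t) x z\<bar> \<le> N * trunc_sq z"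
  unfolding regular_def by blast

lemma u_moll_abs_le: "0 < r \<Longrightarrow> \<bar>u_moll r x t\<bar> \<le> K"
  unfolding u_moll_def by (intro moll_abs_le abs_u_le) auto

lemma u_moll_lim:
  assumes "0 < r" "X \<longlonglongrightarrow> x" "Y \<longlonglongrightarrow> t"
  shows "(\<lambda>n. u_moll r (X n) (Y n)) \<longlonglongrightarrow> u_moll r x t"
  unfolding u_moll_def by (rule moll_tendsto[OF assms(1) _ _ abs_u_le assms(2) u_lim[OF assms(3)]]) auto

lemma u_moll_joint: "0 < r \<Longrightarrow> continuous_on S (\<lambda>p. u_moll r (fst p) (snd p))"
  by (intro continuous_on_sequentiallyI u_moll_lim tendsto_fst tendsto_snd)

lemma u_moll_cont_t: "0 < r \<Longrightarrow> continuous_on S (u_moll r x)"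
  by (intro continuous_on_sequentiallyI u_moll_lim tendsto_const)

lemma u_moll_measurable [measurable]: "0 < r \<Longrightarrow> (\<lambda>x. u_moll r x t) \<in> borel_measurable borel"
  unfolding u_moll_def using continuous_on_moll[OF _ u_measurable abs_u_le, of r t]
  by (auto intro!: borel_measurable_continuous_onI)

lemma u_moll_second_diff:
  assumes "0 < r"
  shows "\<exists>C. \<forall>t x z. \<bar>second_diff (\<lambda>y. u_moll r y t) x z\<bar> \<le> C * trunc_sq z"
proof -
  obtain C where "\<And>v x z. v \<in> borel_measurable borel \<Longrightarrow> (\<And>y. \<bar>v (y::real^'n)\<bar> \<le> K)
      \<Longrightarrow> \<bar>second_diff (moll r v) x z\<bar> \<le> C * trunc_sq z"
    using second_diff_moll_uniform[OF assms, of K, where 'a="real^'n"] by blast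
  then show ?thesis unfolding u_moll_def using u_measurable abs_u_le by (intro exI[of _ C]) blast
qed

lemma u_moll_second_diff_regular:
  assumes "0 < r" "regular N R t" "norm x + r \<le> R"
  shows "\<bar>second_diff (\<lambda>y. u_moll r y t) x z\<bar> \<le> N * trunc_sq z"
  unfolding u_moll_def
proof (rule second_diff_moll_le[OF assms(1) u_measurable abs_u_le])
  fix y :: "real ^ 'n" assume "norm y \<le> r"
  then have "norm (x + y) \<le> R" using assms(3) norm_triangle_ineq[of x y] by linarith
  then show "\<bar>second_diff (\<lambda>y. u y t) (x + y) z\<bar> \<le> N * trunc_sq z" by (rule regularD[OF assms(2)])
qed

lemma moll_rhs_cont_t:
  assumes r: "0 < r"
  shows "continuous_on S (moll_rhs r x)"
proof (rule continuous_on_sequentiallyI)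
  fix X :: "nat \<Rightarrow> real" and t :: real assume X: "X \<longlonglongrightarrow> t"
  obtain C where C: "\<And>t x z. \<bar>second_diff (\<lambda>y. u_moll r y t) x z\<bar> \<le> C * trunc_sq z" using u_moll_second_diff[OF r] by blast
  have [measurable]: "(\<lambda>x. u_moll r x t) \<in> borel_measurable borel" for t by (rule u_moll_measurable[OF r])
  have "(\<lambda>n. LINT z|lborel. second_diff (\<lambda>y. u_moll r y (X n)) x z / frac_kernel s z)
      \<longlonglongrightarrow> (LINT z|lborel. second_diff (\<lambda>y. u_moll r y t) x z / frac_kernel s z)"
  proof (rule integral_dominated_convergence)
    show "integrable lborel (\<lambda>z. C * (trunc_sq z / frac_kernel s (z::real^'n)))"
      by (intro integrable_mult_right kernel_integrable s)
    show "AE z in lborel. (\<lambda>n. second_diff (\<lambda>y. u_moll r y (X n)) x z / frac_kernel s z)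
        \<longlonglongrightarrow> second_diff (\<lambda>y. u_moll r y t) x z / frac_kernel s z"
      unfolding second_diff_def divide_inverse by (intro AE_I2 tendsto_intros u_moll_lim r X)
    show "AE z in lborel. norm (second_diff (\<lambda>y. u_moll r y (X n)) x z / frac_kernel s z) \<le> C * (trunc_sq z / frac_kernel s z)" for n
    proof (rule AE_I2)
      fix z :: "real ^ 'n"
      show "norm (second_diff (\<lambda>y. u_moll r y (X n)) x z / frac_kernel s z) \<le> C * (trunc_sq z / frac_kernel s z)"
        using divide_right_mono[OF C[of "X n" x z] frac_kernel_nonneg[of s z]] by simp
    qed
  qed measurable
  moreover have "(\<lambda>n. moll r (\<lambda>y. f (u y (X n))) x) \<longlonglongrightarrow> moll r (\<lambda>y. f (u y t)) x"
    by (rule moll_tendsto[OF r _ _ abs_f_u_le tendsto_const f_u_lim[OF X]]) auto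
  ultimately show "(\<lambda>n. moll_rhs r x (X n)) \<longlonglongrightarrow> moll_rhs r x t"
    unfolding moll_rhs_def frac_op_def by (intro tendsto_intros) auto
qed

text \<open>The slope of the barrier over a ball of radius \<open>d\<close>; the absolute value and the added \<open>1\<close> make it
nonnegative and the inequality in \<open>barrier_estimate\<close> strict.\<close>

definition barrier_slope :: "real \<Rightarrow> real \<Rightarrow> real"
  where "barrier_slope N d = \<bar>f_bound + c * ((N + 2 * K * bump_bound d) * kernel_mass TYPE('n) s)\<bar> + 1"

text \<open>Upper and lower barrier; the slope does not depend on the mollification radius \<open>r\<close>, because the
second differences of \<open>u(\<cdot>,a)\<close> pass to its mollification.\<close>

lemma u_moll_barrier:
  assumes N: "regular N R a" and ab: "a < b" and ev: "\<And>t. a < t \<Longrightarrow> t \<le> b \<Longrightarrow> moll_evolves R t"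
    and d: "0 < d" "norm x0 + 2 * d \<le> R" and r: "0 < r" "r < d"
  shows "\<bar>u_moll r x0 b - u_moll r x0 a\<bar> \<le> barrier_slope N d * (b - a)"
proof -
  have sp: "0 \<le> barrier_slope N d" "f_bound + c * ((N + 2 * K * bump_bound d) * kernel_mass TYPE('n) s) < barrier_slope N d"
    unfolding barrier_slope_def by linarith+
  have in_R: "norm x + r < R" if "x \<in> ball x0 d" for x
  proof -
    have "norm x \<le> norm x0 + norm (x0 - x)" using norm_triangle_ineq3[of x0 x] norm_minus_commute[of x0 x] by linarith
    then show ?thesis using that d r by (simp add: dist_norm)
  qed
  have der: "(u_moll r x has_real_derivative moll_rhs r x t) (at t)" if "x \<in> ball x0 d" "a < t" "t \<le> b" for x t
    using ev[OF that(2,3)] in_R[OF that(1)] r unfolding moll_evolves_def by blast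
  obtain C where C: "\<And>t x z. \<bar>second_diff (\<lambda>y. u_moll r y t) x z\<bar> \<le> C * trunc_sq z" using u_moll_second_diff[OF r(1)] by blast
  have ini: "\<bar>second_diff (\<lambda>y. u_moll r y a) x z\<bar> \<le> N * trunc_sq z" if "x \<in> ball x0 d" for x z
    using u_moll_second_diff_regular[OF r(1) N] in_R[OF that] by simp
  have F: "\<bar>moll r (\<lambda>y. f (u y t)) x\<bar> \<le> f_bound" for t x
    by (intro moll_abs_le r abs_f_u_le f_u_measurable)
  have "u_moll r x0 b \<le> u_moll r x0 a + barrier_slope N d * (b - a)"
  proof (rule barrier_estimate[where W = "u_moll r" and F = "\<lambda>x t. moll r (\<lambda>y. f (u y t)) x"
        and r = d and M = f_bound and N = N and K = K, OF s])
    show "(u_moll r x has_real_derivative moll r (\<lambda>y. f (u y t)) x - c * frac_op s (\<lambda>y. u_moll r y t) x) (at t)"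
      if "x \<in> ball x0 d" "a < t" "t \<le> b" for x t using der[OF that] unfolding moll_rhs_def .
    show "moll r (\<lambda>y. f (u y t)) x \<le> f_bound" for x t using F[where t=t and x=x] by linarith
    show "continuous_on (cball x0 d \<times> {a..b}) (\<lambda>p. u_moll r (fst p) (snd p))" by (rule u_moll_joint[OF r(1)])
    show "\<exists>N. \<forall>z. \<bar>second_diff (\<lambda>y. u_moll r y t) x z\<bar> \<le> N * trunc_sq z" for x t
      by (intro exI[of _ C] allI C)
    show "\<bar>second_diff (\<lambda>y. u_moll r y a) x z\<bar> \<le> N * trunc_sq z" if "x \<in> ball x0 d" for x z using ini[OF that] .
    show "(\<lambda>x. u_moll r x t) \<in> borel_measurable borel" for t by (rule u_moll_measurable[OF r(1)])
    show "\<bar>u_moll r x t\<bar> \<le> K" for x t by (rule u_moll_abs_le[OF r(1)])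
    show "0 \<le> c" using c by simp
  qed (fact d ab sp)+
  moreover have "- u_moll r x0 b \<le> - u_moll r x0 a + barrier_slope N d * (b - a)"
  proof (rule barrier_estimate[where W = "\<lambda>x t. - u_moll r x t" and F = "\<lambda>x t. - moll r (\<lambda>y. f (u y t)) x"
        and r = d and M = f_bound and N = N and K = K, OF s])
    show "((\<lambda>t. - u_moll r x t) has_real_derivative
        - moll r (\<lambda>y. f (u y t)) x - c * frac_op s (\<lambda>y. - u_moll r y t) x) (at t)"
      if "x \<in> ball x0 d" "a < t" "t \<le> b" for x t
    proof -
      have "- moll r (\<lambda>y. f (u y t)) x - c * frac_op s (\<lambda>y. - u_moll r y t) x = - moll_rhs r x t"
        unfolding moll_rhs_def frac_op_minus by simp
      then show ?thesis using DERIV_minus[OF der[OF that]] by (simp only:)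
    qed
    show "- moll r (\<lambda>y. f (u y t)) x \<le> f_bound" for x t using F[where t=t and x=x] by linarith
    have sm: "second_diff (\<lambda>y. - u_moll r y t) x z = - second_diff (\<lambda>y. u_moll r y t) x z" for t x z by (simp add: second_diff_def)
    show "\<exists>N. \<forall>z. \<bar>second_diff (\<lambda>y. - u_moll r y t) x z\<bar> \<le> N * trunc_sq z" for x t
      unfolding sm using C by (intro exI[of _ C]) simp
    show "\<bar>second_diff (\<lambda>y. - u_moll r y a) x z\<bar> \<le> N * trunc_sq z" if "x \<in> ball x0 d" for x z
      unfolding sm using ini[OF that] by simp
    show "continuous_on (cball x0 d \<times> {a..b}) (\<lambda>p. - u_moll r (fst p) (snd p))"
      by (intro continuous_on_minus u_moll_joint[OF r(1)])
    show "(\<lambda>x. - u_moll r x t) \<in> borel_measurable borel" for t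
      by (intro borel_measurable_uminus u_moll_measurable[OF r(1)])
    show "\<bar>- u_moll r x t\<bar> \<le> K" for x t using u_moll_abs_le[OF r(1)] by simp
    show "0 \<le> c" using c by simp
  qed (fact d ab sp)+
  ultimately show ?thesis by linarith
qed

lemma u_moll_near_u:
  assumes "0 < e"
  shows "\<exists>d>0. \<forall>r. 0 < r \<and> r < d \<longrightarrow> \<bar>u_moll r x t - u x t\<bar> \<le> e"
proof -
  obtain d where d: "d > 0" "\<And>y. dist y x < d \<Longrightarrow> dist (u y t) (u x t) < e"
    using cont_x[of t] assms unfolding continuous_on_iff by (metis UNIV_I)
  have "\<bar>u_moll r x t - u x t\<bar> \<le> e" if r: "0 < r" "r < d" for r
    unfolding u_moll_def
  proof (rule moll_near[OF r(1) u_measurable])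
    fix y :: "real ^ 'n" assume "norm y \<le> r"
    then have "dist (x + y) x < d" using r by (simp add: dist_norm)
    then show "\<bar>u (x + y) t - u x t\<bar> \<le> e" using d(2)[of "x + y"] by (simp add: dist_real_def)
  qed
  then show ?thesis using d(1) by blast
qed

lemma u_barrier_closed:
  assumes N: "regular N R a" and ab: "a < b" and ev: "\<And>t. a < t \<Longrightarrow> t \<le> b \<Longrightarrow> moll_evolves R t"
    and d: "0 < d" "norm x0 + 2 * d \<le> R"
  shows "\<bar>u x0 b - u x0 a\<bar> \<le> barrier_slope N d * (b - a)"
proof (rule field_le_epsilon)
  fix e :: real assume e: "0 < e"
  obtain d1 where d1: "d1 > 0" "\<And>r. 0 < r \<Longrightarrow> r < d1 \<Longrightarrow> \<bar>u_moll r x0 a - u x0 a\<bar> \<le> e / 2"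
    using u_moll_near_u[of "e / 2" x0 a] e by auto
  obtain d2 where d2: "d2 > 0" "\<And>r. 0 < r \<Longrightarrow> r < d2 \<Longrightarrow> \<bar>u_moll r x0 b - u x0 b\<bar> \<le> e / 2"
    using u_moll_near_u[of "e / 2" x0 b] e by auto
  define r where "r = min d (min d1 d2) / 2"
  have r: "0 < r" "r < d" "r < d1" "r < d2" unfolding r_def using d d1(1) d2(1) by auto
  show "\<bar>u x0 b - u x0 a\<bar> \<le> barrier_slope N d * (b - a) + e"
    using u_moll_barrier[OF N ab ev d r(1,2)] d1(2)[OF r(1,3)] d2(2)[OF r(1,4)] by linarith
qed

text \<open>The mollified equation is required only strictly between the two times, so that the estimate reaches
the right end of a gap in the set of exceptional times.\<close>

lemma u_barrier:
  assumes N: "regular N R a" and ab: "a < b" and ev: "\<And>t. a < t \<Longrightarrow> t < b \<Longrightarrow> moll_evolves R t"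
    and d: "0 < d" "norm x0 + 2 * d \<le> R"
  shows "\<bar>u x0 b - u x0 a\<bar> \<le> barrier_slope N d * (b - a)"
proof (rule tendsto_le[of "at_left b"])
  have "isCont (u x0) b" using cont_t[of UNIV x0] by (simp add: continuous_on_eq_continuous_at)
  then have "(u x0 \<longlongrightarrow> u x0 b) (at_left b)" unfolding isCont_def by (rule filterlim_at_split[THEN iffD1, THEN conjunct1])
  then show "((\<lambda>t. \<bar>u x0 t - u x0 a\<bar>) \<longlongrightarrow> \<bar>u x0 b - u x0 a\<bar>) (at_left b)"
    by (intro tendsto_intros)
  show "((\<lambda>t. barrier_slope N d * (t - a)) \<longlongrightarrow> barrier_slope N d * (b - a)) (at_left b)"
    by (intro tendsto_intros)
  have "eventually (\<lambda>t. t \<in> {a<..<b}) (at_left b)" using ab by (rule eventually_at_left_real)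
  then show "eventually (\<lambda>t. \<bar>u x0 t - u x0 a\<bar> \<le> barrier_slope N d * (t - a)) (at_left b)"
    by eventually_elim (use u_barrier_closed[OF N _ _ d] ev in auto)
qed simp

lemma u_deriv_regular:
  assumes "regular N R t" "norm x \<le> R"
  shows "\<bar>f (u x t) - c * frac_op s (\<lambda>y. u y t) x\<bar> \<le> f_bound + c * (N * kernel_mass TYPE('n) s)"
proof -
  have "\<bar>frac_op s (\<lambda>y. u y t) x\<bar> \<le> N * kernel_mass TYPE('n) s"
    by (rule frac_op_abs_le[OF s u_measurable regularD[OF assms]])
  then have "\<bar>c * frac_op s (\<lambda>y. u y t) x\<bar> \<le> c * (N * kernel_mass TYPE('n) s)"
    using c by (simp add: abs_mult)
  then show ?thesis using abs_f_u_le[of x t] by linarith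
qed

text \<open>Continuous induction along the exceptional times.  From an exceptional time one moves right either by
a short step, using the bound for the time derivative given by the equation, or across a gap, using
the barrier.\<close>

lemma right_lipschitz:
  assumes E: "closed E" and good: "\<And>t. t \<in> J - E \<Longrightarrow> moll_evolves R t"
    and J: "is_interval J" and N: "\<And>t. t \<in> E \<inter> J \<Longrightarrow> regular N R t"
    and d: "0 < d" "norm x + 2 * d \<le> R" and ab: "a \<in> E \<inter> J" "b \<in> J" "a < b"
  shows "\<bar>u x b - u x a\<bar> \<le> (barrier_slope N d + (f_bound + c * (\<bar>N\<bar> * kernel_mass TYPE('n) s)) + 1) * (b - a)"
proof -
  define B where "B = barrier_slope N d + (f_bound + c * (\<bar>N\<bar> * kernel_mass TYPE('n) s)) + 1"
  have mass0: "0 \<le> kernel_mass TYPE('n) s" by (rule kernel_mass_nonneg)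
  have sp: "0 \<le> barrier_slope N d" unfolding barrier_slope_def by linarith
  have cN: "c * (N * kernel_mass TYPE('n) s) \<le> c * (\<bar>N\<bar> * kernel_mass TYPE('n) s)" using c mass0 by (intro mult_left_mono mult_right_mono) auto
  have B1: "barrier_slope N d \<le> B" "f_bound + c * (N * kernel_mass TYPE('n) s) < B"
    using sp cN f_bound_nonneg c mass0 
  proof -
    have "0 \<le> c * (\<bar>N\<bar> * kernel_mass TYPE('n) s)" using c mass0 by simp
    then show "barrier_slope N d \<le> B" "f_bound + c * (N * kernel_mass TYPE('n) s) < B"
      using sp cN f_bound_nonneg unfolding B_def by linarith+
  qed
  have sub: "{a..b} \<subseteq> J"
  proof
    fix t assume "t \<in> {a..b}"
    then show "t \<in> J" using mem_is_interval_1_I[OF J, of a b t] ab by simp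
  qed
  (* The end point b need not be an exceptional time. *)
  define S where "S = (E \<inter> {a..b}) \<union> {b}"
  have cS: "closed S" unfolding S_def by (intro closed_Un closed_Int closed_atLeastAtMost closed_singleton E)
  (* The sign gives the upper and the lower bound at once. *)
  have "\<sigma> * u x b \<le> \<sigma> * u x a + B * (b - a)" if \<sigma>: "\<sigma> = 1 \<or> \<sigma> = -1" for \<sigma> :: real
  proof (rule continuous_induction_le[of S a b "\<lambda>t. \<sigma> * u x t" B])
    show "\<exists>\<eta>>0. \<forall>\<sigma>'\<in>S. \<tau> - \<eta> < \<sigma>' \<and> \<sigma>' \<le> \<tau> \<longrightarrow> \<sigma> * u x \<tau> \<le> \<sigma> * u x \<sigma>' + e"
      if "\<tau> \<in> S" "0 < e" for \<tau> e
      by (rule continuous_left_bound[of S "\<lambda>t. \<sigma> * u x t", OF _ that]) (intro continuous_intros cont_t)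
    fix \<tau> assume \<tau>: "\<tau> \<in> S" "\<tau> < b"
    then have \<tau>E: "\<tau> \<in> E \<inter> J" "a \<le> \<tau>" using sub unfolding S_def by auto
    note reg = N[OF \<tau>E(1)]
    have xR: "norm x \<le> R" using d by linarith
    define D where "D = \<sigma> * (f (u x \<tau>) - c * frac_op s (\<lambda>y. u y \<tau>) x)"
    have "((\<lambda>t. \<sigma> * u x t) has_real_derivative D) (at \<tau>)"
      unfolding D_def by (intro DERIV_cmult evol)
    then have "((\<lambda>t. \<sigma> * u x t) has_real_derivative D) (at_right \<tau>)"
      by (rule has_field_derivative_at_within)
    moreover have "D < B"
    proof -
      have "D \<le> \<bar>f (u x \<tau>) - c * frac_op s (\<lambda>y. u y \<tau>) x\<bar>"
        using \<sigma> unfolding D_def by (elim disjE) simp_all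
      then show ?thesis using u_deriv_regular[OF reg xR] B1(2) by linarith
    qed
    ultimately obtain \<eta> where \<eta>: "\<eta> > 0"
      "\<And>h. 0 \<le> h \<Longrightarrow> h < \<eta> \<Longrightarrow> \<sigma> * u x (\<tau> + h) \<le> \<sigma> * u x \<tau> + B * h"
      using right_derivative_step[of "\<lambda>t. \<sigma> * u x t" D \<tau> B] by blast
    show "\<exists>\<nu>\<in>S. \<tau> < \<nu> \<and> \<sigma> * u x \<nu> \<le> \<sigma> * u x \<tau> + B * (\<nu> - \<tau>)"
    proof (cases "\<exists>\<nu>\<in>S. \<tau> < \<nu> \<and> \<nu> < \<tau> + \<eta>")
      case True
      then obtain \<nu> where "\<nu> \<in> S" "\<tau> < \<nu>" "\<nu> < \<tau> + \<eta>" by blast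
      then show ?thesis using \<eta>(2)[of "\<nu> - \<tau>"] by (intro bexI[of _ \<nu>]) auto
    next
      case False
      define S' where "S' = S \<inter> {\<tau> + \<eta>..}"
      have bS: "b \<in> S'" using False \<tau>(2) unfolding S'_def S_def by force
      have bdd: "bdd_below S'" unfolding S'_def by (intro bdd_belowI[of _ "\<tau> + \<eta>"]) auto
      have clS': "closed S'" unfolding S'_def using cS by auto
      (* The right end of the gap that starts at \<tau>. *)
      define \<nu> where "\<nu> = Inf S'"
      have \<nu>S: "\<nu> \<in> S'" unfolding \<nu>_def using closed_contains_Inf[OF _ bdd clS'] bS by auto
      have \<nu>lt: "\<tau> < \<nu>" using \<nu>S \<eta>(1) unfolding S'_def by auto
      have "\<nu> \<le> b" unfolding \<nu>_def using bS bdd by (rule cInf_lower)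
      have free: "moll_evolves R t" if t: "\<tau> < t" "t < \<nu>" for t
      proof (rule good)
        have "t \<notin> S'" using t(2) cInf_lower[OF _ bdd] unfolding \<nu>_def by force
        then have "t \<notin> S" using False t unfolding S'_def by force
        moreover have "t \<in> {a..b}" using t \<tau>E(2) \<open>\<nu> \<le> b\<close> by auto
        ultimately show "t \<in> J - E" using sub unfolding S_def by auto
      qed
      have "\<bar>u x \<nu> - u x \<tau>\<bar> \<le> barrier_slope N d * (\<nu> - \<tau>)"
        by (rule u_barrier[OF reg \<nu>lt free d])
      also have "\<dots> \<le> B * (\<nu> - \<tau>)" using B1(1) \<nu>lt by (intro mult_right_mono) auto
      finally have le: "\<bar>u x \<nu> - u x \<tau>\<bar> \<le> B * (\<nu> - \<tau>)" .
      have "\<sigma> * u x \<nu> - \<sigma> * u x \<tau> \<le> \<bar>u x \<nu> - u x \<tau>\<bar>"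
        using \<sigma> by (elim disjE) simp_all
      then have "\<sigma> * u x \<nu> \<le> \<sigma> * u x \<tau> + B * (\<nu> - \<tau>)" using le by linarith
      then show ?thesis using \<nu>S \<nu>lt unfolding S'_def by blast
    qed
  next
    show "closed S" "a \<in> S" "b \<in> S" "S \<subseteq> {a..b}" using cS ab unfolding S_def by auto
  qed
  from this[of 1] this[of "-1"] show ?thesis unfolding B_def[symmetric] by simp
qed

text \<open>The one-sided Lipschitz bound dominates the difference quotients of \<open>u\<close> under the mollifying integral.\<close>

lemma u_moll_right_derivative:
  assumes N: "regular N R a" and r: "0 < r" "norm x + r \<le> R" and \<beta>: "a < \<beta>"
    and B: "\<And>y b. norm y \<le> norm x + r \<Longrightarrow> a < b \<Longrightarrow> b < \<beta> \<Longrightarrow> \<bar>u y b - u y a\<bar> \<le> B * (b - a)"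
  shows "(u_moll r x has_real_derivative moll_rhs r x a) (at_right a)"
proof -
  define g where "g y = f (u (x + y) a) - c * frac_op s (\<lambda>y. u y a) (x + y)" for y
  have mem: "norm (x + y) \<le> norm x + r" if "norm y \<le> r" for y
    using norm_triangle_ineq[of x y] that by linarith
  have [measurable]: "(\<lambda>p::(real^'n)\<times>(real^'n). second_diff (\<lambda>y. u y a) (x + fst p) (snd p)) \<in> borel_measurable (borel \<Otimes>\<^sub>M borel)"
    unfolding second_diff_def by measurable
  have mL[measurable]: "(\<lambda>y. frac_op s (\<lambda>y. u y a) (x + y)) \<in> borel_measurable borel"
    unfolding frac_op_def by measurable
  have mg[measurable]: "g \<in> borel_measurable borel" unfolding g_def[abs_def] by measurable
  have Lb: "\<bar>frac_op s (\<lambda>y. u y a) (x + y)\<bar> \<le> N * kernel_mass TYPE('n) s" if "norm y \<le> r" for y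
    using mem[OF that] r(2) by (intro frac_op_abs_le[OF s u_measurable] regularD[OF N]) linarith
  have "(LINT y|lborel. moll_kernel r y * g y)
      = (LINT y|lborel. moll_kernel r y * f (u (x + y) a) - c * (moll_kernel r y * frac_op s (\<lambda>y. u y a) (x + y)))"
    unfolding g_def by (simp add: algebra_simps)
  also have "\<dots> = (LINT y|lborel. moll_kernel r y * f (u (x + y) a))
      - (LINT y|lborel. c * (moll_kernel r y * frac_op s (\<lambda>y. u y a) (x + y)))"
  proof (intro Bochner_Integration.integral_diff integrable_mult_right)
    show "integrable lborel (\<lambda>y. moll_kernel r y * f (u (x + y) a))"
      by (rule integrable_moll_kernel_mult[OF r(1) _ abs_f_u_le]) measurable
    show "integrable lborel (\<lambda>y. moll_kernel r y * frac_op s (\<lambda>y. u y a) (x + y))"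
      by (rule integrable_moll_kernel_mult[OF r(1) mL Lb])
  qed
  also have "\<dots> = moll_rhs r x a"
  proof -
    have "\<bar>second_diff (\<lambda>y. u y a) (x + y) z\<bar> \<le> N * trunc_sq z" if "norm y \<le> r" for y z
      using regularD[OF N] mem[OF that] r(2) by force
    then have "frac_op s (moll r (\<lambda>y. u y a)) x = (LINT y|lborel. moll_kernel r y * frac_op s (\<lambda>y. u y a) (x + y))"
      by (rule frac_op_moll[OF s r(1) cont_x abs_u_le])
    then show ?thesis
      unfolding moll_rhs_def u_moll_def[abs_def] integral_mult_right_zero by (simp add: moll_def[of r "\<lambda>y. f (u y a)"])
  qed
  finally have Geq: "moll_rhs r x a = (LINT y|lborel. moll_kernel r y * g y)" ..
  have "((\<lambda>b. (u_moll r x b - u_moll r x a) / (b - a)) \<longlongrightarrow> moll_rhs r x a) (at_right a)"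
  proof (rule tendsto_at_right_sequentially[OF \<beta>])
    fix X :: "nat \<Rightarrow> real"
    assume X: "\<And>n. a < X n" "\<And>n. X n < \<beta>" "X \<longlonglongrightarrow> a"
    define q where "q n y = (u (x + y) (X n) - u (x + y) a) / (X n - a)" for n y
    have [measurable]: "q n \<in> borel_measurable borel" for n unfolding q_def[abs_def] by measurable
    have qB: "\<bar>q n y\<bar> \<le> B" if "norm y \<le> r" for n y
      using B[OF mem[OF that] X(1,2), of n] X(1)[of n] unfolding q_def by (simp add: abs_divide divide_le_eq)
    have Vq: "(u_moll r x (X n) - u_moll r x a) / (X n - a) = (LINT y|lborel. moll_kernel r y * q n y)" for n
    proof -
      have i: "integrable lborel (\<lambda>y. moll_kernel r y * u (x + y) t)" for t
        by (rule integrable_moll_kernel_mult[OF r(1) _ abs_u_le]) measurable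
      have "(LINT y|lborel. moll_kernel r y * q n y)
          = (LINT y|lborel. (moll_kernel r y * u (x + y) (X n) - moll_kernel r y * u (x + y) a) / (X n - a))"
        unfolding q_def by (simp add: algebra_simps)
      also have "\<dots> = (u_moll r x (X n) - u_moll r x a) / (X n - a)"
        unfolding u_moll_def moll_def integral_divide_zero using i by simp
      finally show ?thesis ..
    qed
    have "(\<lambda>n. LINT y|lborel. moll_kernel r y * q n y) \<longlonglongrightarrow> (LINT y|lborel. moll_kernel r y * g y)"
    proof (rule integral_dominated_convergence)
      show "integrable lborel (\<lambda>y::real^'n. B * moll_kernel r y)"
        by (intro integrable_mult_right integrable_moll_kernel r)
      show "AE y in lborel. (\<lambda>n. moll_kernel r y * q n y) \<longlonglongrightarrow> moll_kernel r y * g y"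
      proof (intro AE_I2 tendsto_mult tendsto_const)
        fix y :: "real ^ 'n"
        have "((\<lambda>b. (u (x + y) b - u (x + y) a) / (b - a)) \<longlongrightarrow> g y) (at a)"
          using evol[of "x + y" a] unfolding g_def has_field_derivative_iff .
        moreover have "filterlim X (at a) sequentially"
          using X(1) X(3) by (auto simp: filterlim_at intro!: always_eventually)
        ultimately show "(\<lambda>n. q n y) \<longlonglongrightarrow> g y" unfolding q_def by (rule filterlim_compose)
      qed
      show "AE y in lborel. norm (moll_kernel r y * q n y) \<le> B * moll_kernel r y" for n
      proof (rule AE_I2)
        fix y :: "real ^ 'n"
        show "norm (moll_kernel r y * q n y) \<le> B * moll_kernel r y"
        proof (cases "norm y \<le> r")
          case True
          then show ?thesis using mult_left_mono[OF qB[OF True, of n] moll_kernel_nonneg[OF r(1), of y]] r(1)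
            by (simp add: abs_mult mult.commute)
        next
          case False
          then show ?thesis using moll_kernel_eq_0[OF r(1), of y] by simp
        qed
      qed
    qed measurable
    then show "(\<lambda>n. (u_moll r x (X n) - u_moll r x a) / (X n - a)) \<longlonglongrightarrow> moll_rhs r x a" unfolding Vq Geq .
  qed
  then show ?thesis by (simp add: has_field_derivative_iff)
qed

lemma closed_regular: "closed {t. regular N R t}"
  unfolding regular_def
proof (intro closed_Collect_all closed_Collect_imp open_Collect_const)
  fix x z :: "real ^ 'n"
  show "closed {t. \<bar>second_diff (\<lambda>y. u y t) x z\<bar> \<le> N * trunc_sq z}"
    unfolding second_diff_def by (intro closed_Collect_le continuous_intros cont_t)
qed

lemma regular_mono: "regular N R t \<Longrightarrow> N \<le> N' \<Longrightarrow> regular N' R t"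
  unfolding regular_def by (meson trunc_sq_nonneg mult_right_mono order_trans)

text \<open>Baire's theorem on the closed set of exceptional times yields an interval on which these times share one
bound for the second differences; on that interval the mollified equation is then recovered.\<close>

lemma moll_evolves_everywhere: "moll_evolves R t"
proof (rule ccontr)
  assume bad: "\<not> moll_evolves R t"
  define E where "E = - interior {t. moll_evolves R t}"
  have cE: "closed E" unfolding E_def by (intro closed_Compl open_interior)
  have tE: "t \<in> E" using bad interior_subset unfolding E_def by blast
  define A where "A n = {t\<in>E. regular (real n) R t}" for n :: nat
  have cA: "closed (A n)" for n
    unfolding A_def Collect_conj_eq Collect_mem_eq by (intro closed_Int cE closed_regular)
  have cover: "\<exists>n. t \<in> A n" if "t \<in> E" for t
  proof -
    obtain N where "regular N R t" using regular_ex by blast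
    then have "regular (real (nat \<lceil>N\<rceil>)) R t" by (rule regular_mono) (rule real_nat_ceiling_ge)
    then show ?thesis using that unfolding A_def by blast
  qed
  have "\<exists>n. \<not> E \<subseteq> closure (E - A n)"
  proof (rule ccontr)
    assume "\<nexists>n. \<not> E \<subseteq> closure (E - A n)"
    then have dense: "E \<subseteq> closure (E - A n)" for n by blast
    have op: "openin (top_of_set E) (E - A n)" for n
    proof -
      have "E - A n = E \<inter> - A n" by blast
      then show ?thesis using cA[of n] by (auto simp: openin_open)
    qed
    have "E \<subseteq> closure (\<Inter>(range (\<lambda>n. E - A n)))"
      by (rule Baire[OF cE]) (use dense op in auto)
    moreover have "\<Inter>(range (\<lambda>n. E - A n)) = {}" using cover by blast
    ultimately have "E \<subseteq> closure {}" by (simp only:)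
    then show False using tE by simp
  qed
  then obtain n t0 where t0: "t0 \<in> E" "t0 \<notin> closure (E - A n)" by blast
  have "open (- closure (E - A n))" by (intro open_Compl closed_closure)
  then obtain e where e: "e > 0" "ball t0 e \<subseteq> - closure (E - A n)"
    using t0(2) open_contains_ball by blast
  define J where "J = ball t0 e"
  have J: "open J" "is_interval J" unfolding J_def by (auto simp: is_interval_ball_real)
  have regJ: "regular (real n) R t" if "t \<in> E \<inter> J" for t
    using e(2) that closure_subset[of "E - A n"] unfolding J_def A_def by blast
  have good: "moll_evolves R t" if "t \<in> J - E" for t
    using that interior_subset unfolding E_def by blast
  have "moll_evolves R t" if tJ: "t \<in> J" for t
    unfolding moll_evolves_def
  proof (intro allI impI)
    fix r x assume r: "0 < r \<and> norm (x::real^'n) + r < R"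
    (* Half of the distance that is left between the mollification ball and the ball of radius R. *)
    define d where "d = (R - norm x - r) / 2"
    have d: "0 < d" using r unfolding d_def by simp
    show "(u_moll r x has_real_derivative moll_rhs r x t) (at t)"
    proof (rule derivative_from_right[OF J _ _ _ tJ])
      show "continuous_on J (u_moll r x)" "continuous_on J (moll_rhs r x)" using r u_moll_cont_t moll_rhs_cont_t by blast+
      fix a assume aJ: "a \<in> J"
      show "(u_moll r x has_real_derivative moll_rhs r x a) (at_right a)"
      proof (cases "a \<in> E")
        case True
        obtain \<delta> where \<delta>: "\<delta> > 0" "ball a \<delta> \<subseteq> J" using J(1) aJ open_contains_ball by blast
        show ?thesis
        proof (rule u_moll_right_derivative)
          show "regular (real n) R a" using regJ True aJ by blast
          show "0 < r" "norm x + r \<le> R" "a < a + \<delta>" using r \<delta>(1) by auto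
          fix y :: "real ^ 'n" and b
          assume y: "norm y \<le> norm x + r" and b: "a < b" "b < a + \<delta>"
          have "b \<in> J" using \<delta>(2) b by (auto simp: subset_iff dist_real_def)
          moreover have "norm y + 2 * d \<le> R" using y unfolding d_def by (simp add: field_simps)
          ultimately show "\<bar>u y b - u y a\<bar>
              \<le> (barrier_slope (real n) d + (f_bound + c * (\<bar>real n\<bar> * kernel_mass TYPE('n) s)) + 1) * (b - a)"
            using right_lipschitz[OF cE good J(2) regJ d, of y a b] True aJ b(1) by blast
        qed
      next
        case False
        then have "moll_evolves R a" using good aJ by blast
        then have "(u_moll r x has_real_derivative moll_rhs r x a) (at a)" using r unfolding moll_evolves_def by blast
        then show ?thesis by (rule has_field_derivative_at_within)
      qed
    qed
  qed
  then have "J \<subseteq> {t. moll_evolves R t}" by blast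
  then have "J \<subseteq> interior {t. moll_evolves R t}" using J(1) by (rule interior_maximal)
  moreover have "t0 \<in> J" using e(1) unfolding J_def by simp
  ultimately show False using t0(1) unfolding E_def by blast
qed

text \<open>The constant depends on \<open>a\<close>; only the uniformity in \<open>x\<close> and in \<open>b > a\<close> matters, and it makes localised
spatial suprema upper semicontinuous from the right in time.\<close>

lemma locally_uniform_right_lipschitz:
  obtains B where "0 \<le> B" "\<And>x b. norm x \<le> R \<Longrightarrow> a < b \<Longrightarrow> \<bar>u x b - u x a\<bar> \<le> B * (b - a)"
proof -
  obtain N where N: "regular N (R + 2) a" using regular_ex by blast
  have "\<bar>u x b - u x a\<bar> \<le> barrier_slope N 1 * (b - a)" if "norm x \<le> R" "a < b" for x b
    by (rule u_barrier[OF N that(2)]) (use that moll_evolves_everywhere in auto)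
  moreover have "0 \<le> barrier_slope N 1" unfolding barrier_slope_def by linarith
  ultimately show ?thesis by (rule that[rotated])
qed

end

section \<open>Liouville theorem in space\<close>

text \<open>Integrate the hypothesis over a ball about \<open>0\<close>, translate each summand by \<open>k h\<close>, and compare with the
kernel.  The radius \<open>|h|/2\<close> keeps the translated balls away from the origin, where
\<open>1 / frac_kernel\<close> has the default value \<open>0\<close> and no lower bound holds.\<close>

lemma frac_op_ge_at_max:
  fixes q :: "real ^ 'n \<Rightarrow> real"
  assumes s: "0 < s" "s < 1" and m[measurable]: "q \<in> borel_measurable borel"
    and sd: "\<And>z. \<bar>second_diff q x z\<bar> \<le> N * trunc_sq z"
    and mx: "\<And>y. q y \<le> q x"
    and h: "h \<noteq> 0" and n: "0 < n"
    and spread: "\<And>z. norm z < norm h / 2 \<Longrightarrow> 1 \<le> (\<Sum>k=1..n. q x - q (x + (real k *\<^sub>R h + z)))"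
  shows "measure lborel (ball (0::real ^ 'n) (norm h / 2))
      / ((real (n + 1) * norm h) powr (real CARD('n) + 2 * s)) / (2 * real n) \<le> frac_op s q x"
proof -
  define J where "J = 1 / ((real (n + 1) * norm h) powr (real CARD('n) + 2 * s))"
  define S where "S z = second_diff q x z / frac_kernel s z" for z
  have p: "0 < real CARD('n) + 2 * s" using s by simp
  have mS[measurable]: "S \<in> borel_measurable borel" unfolding S_def[abs_def] by measurable
  have iS: "integrable lborel S" unfolding S_def[abs_def] by (rule integrable_second_diff[OF s m sd])
  have J0: "0 \<le> J" unfolding J_def by simp
  have sd0: "q x - q (x + z) \<le> second_diff q x z" "0 \<le> q x - q (x + z)" for z
    using mx[of "x + z"] mx[of "x - z"] unfolding second_diff_def by linarith+
  have S0: "0 \<le> S z" for z using sd0[of z] unfolding S_def by (intro divide_nonneg_nonneg) auto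
  have pw: "J * indicator (ball 0 (norm h / 2)) z \<le> (\<Sum>k=1..n. S (real k *\<^sub>R h + z))" for z
  proof (cases "norm z < norm h / 2")
    case True
    have "J * (q x - q (x + (real k *\<^sub>R h + z))) \<le> S (real k *\<^sub>R h + z)" if k: "k \<in> {1..n}" for k
    proof -
      define y where "y = real k *\<^sub>R h + z"
      have "norm (real k *\<^sub>R h) = real k * norm h" by simp
      moreover have "1 * norm h \<le> real k * norm h" "real k * norm h \<le> real n * norm h"
        using k by (intro mult_right_mono; simp)+
      moreover have "norm (real k *\<^sub>R h) - norm z \<le> norm y" "norm y \<le> norm (real k *\<^sub>R h) + norm z"
        unfolding y_def by (rule norm_diff_ineq, rule norm_triangle_ineq)
      moreover have "real (n + 1) * norm h = real n * norm h + norm h" by (simp add: algebra_simps)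
      moreover have "0 < norm h" using h by simp
      ultimately have y: "0 < norm y" "norm y \<le> real (n + 1) * norm h"
        using True by linarith+
      have fk: "0 < frac_kernel s y" using y(1) unfolding frac_kernel_def by simp
      have "frac_kernel s y \<le> (real (n + 1) * norm h) powr (real CARD('n) + 2 * s)"
        unfolding frac_kernel_def using y p by (intro powr_mono2) auto
      then have "J \<le> 1 / frac_kernel s y" unfolding J_def using fk by (intro frac_le) auto
      then have "J * (q x - q (x + y)) \<le> 1 / frac_kernel s y * second_diff q x y"
        using sd0[of y] J0 by (intro mult_mono) auto
      then show ?thesis unfolding S_def y_def by simp
    qed
    then have "(\<Sum>k=1..n. J * (q x - q (x + (real k *\<^sub>R h + z)))) \<le> (\<Sum>k=1..n. S (real k *\<^sub>R h + z))"
      by (rule sum_mono)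
    moreover have "J * 1 \<le> J * (\<Sum>k=1..n. q x - q (x + (real k *\<^sub>R h + z)))"
      by (rule mult_left_mono[OF spread[OF True] J0])
    ultimately show ?thesis using True by (simp add: sum_distrib_left)
  next
    case False
    then show ?thesis by (simp add: sum_nonneg S0)
  qed
  have iSk: "integrable lborel (\<lambda>z. S (a + z))" for a
  proof -
    have "integrable (distr lborel borel ((+) a)) S \<longleftrightarrow> integrable lborel (\<lambda>z. S (a + z))"
      by (rule integrable_distr_eq) measurable
    then show ?thesis using iS unfolding lborel_distr_plus by simp
  qed
  have "J * measure lborel (ball (0::real ^ 'n) (norm h / 2))
      = (LINT z|lborel. J * indicator (ball (0::real ^ 'n) (norm h / 2)) z)" by simp
  also have "\<dots> \<le> (LINT z|lborel. (\<Sum>k=1..n. S (real k *\<^sub>R h + z)))"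
  proof (rule integral_mono)
    show "integrable lborel (\<lambda>z. J * indicator (ball (0::real ^ 'n) (norm h / 2)) z)"
      using emeasure_lborel_ball_finite[of "0::real^'n" "norm h / 2"]
      by (intro integrable_mult_right integrable_real_indicator) auto
    show "integrable lborel (\<lambda>z. \<Sum>k=1..n. S (real k *\<^sub>R h + z))"
      by (intro Bochner_Integration.integrable_sum iSk)
  qed (rule pw)
  also have "\<dots> = (\<Sum>k=1..n. LINT z|lborel. S (real k *\<^sub>R h + z))"
    by (intro Bochner_Integration.integral_sum iSk)
  also have "\<dots> = (\<Sum>k=1..n. LINT z|lborel. S z)"
    by (intro sum.cong refl lborel_integral_shift mS)
  also have "\<dots> = real n * (2 * frac_op s q x)" unfolding S_def frac_op_def by simp
  finally have "J * measure lborel (ball (0::real ^ 'n) (norm h / 2)) / (2 * real n) \<le> frac_op s q x"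
    using n by (simp add: divide_le_eq mult_ac)
  then show ?thesis unfolding J_def by (simp add: mult_ac)
qed

context frac_flow
begin

text \<open>The Liouville argument.  The positive supremum \<open>M\<close> of \<open>w\<close> need not be attained, so \<open>w\<close> is lowered by a
small multiple \<open>\<eta>\<close> of a fixed cutoff centred at a point where \<open>w > M - \<eta>/2\<close> at some time.  The modified function
\<open>q\<close> attains its spatial supremum \<open>g t\<close> over the unit ball, and this is a global maximum as long as
\<open>g t \<ge> M - \<eta>/2\<close>.  The term produced by the cutoff is at most \<open>\<kappa>/2\<close>, so half of the lower bound for the
nonlocal operator survives.\<close>

lemma translate_le: "u (x + h) t \<le> u x t"
proof (rule ccontr)
  assume "\<not> u (x + h) t \<le> u x t"
  then have incr: "0 < u (x + h) t - u x t" by simp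
  then have h: "h \<noteq> 0" by auto
  define w where "w x t = u (x + h) t - u x t" for x t
  define M where "M = (SUP p. w (fst p) (snd p))"
  have wK: "\<bar>w x t\<bar> \<le> K" for x t using range[of x t] range[of "x + h" t] unfolding w_def by linarith
  have wK': "w x t \<le> K" for x t using wK[of x t] by linarith
  have bdd: "bdd_above (range (\<lambda>p. w (fst p) (snd p)))" by (rule bdd_aboveI2[of _ _ K]) (rule wK')
  have wM: "w x t \<le> M" for x t unfolding M_def using cSUP_upper[OF _ bdd, of "(x, t)"] by simp
  have M: "0 < M" using wM[of x t] incr unfolding w_def by linarith
  have near: "\<exists>x t. M - e < w x t" if "0 < e" for e
  proof (rule ccontr)
    assume "\<nexists>x t. M - e < w x t"
    then have "\<And>p. w (fst p) (snd p) \<le> M - e" by (meson not_le)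
    then have "M \<le> M - e" unfolding M_def by (intro cSUP_least) auto
    then show False using that by simp
  qed
  (* Chosen so that n times M/2 exceeds the bound of the telescoping sum by at least 1. *)
  define n where "n = nat \<lceil>2 * (K + 1) / M\<rceil>"
  have nM: "2 * (K + 1) \<le> real n * M"
    using M real_nat_ceiling_ge[of "2 * (K + 1) / M"] unfolding n_def by (simp add: pos_divide_le_eq)
  have n0: "0 < n"
  proof (rule ccontr)
    assume "\<not> 0 < n"
    then show False using nM K_nonneg by simp
  qed
  define \<kappa> where "\<kappa> = measure lborel (ball (0::real ^ 'n) (norm h / 2))
      / ((real (n + 1) * norm h) powr (real CARD('n) + 2 * s)) / (2 * real n)"
  have \<kappa>: "0 < \<kappa>" unfolding \<kappa>_def using h n0 content_ball_pos[of "norm h / 2" "0::real^'n"]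
    by (intro divide_pos_pos) auto
  define P where "P = bump_bound 1 * kernel_mass TYPE('n) s"
  have P: "0 \<le> P" unfolding P_def using bump_bound_nonneg[of 1] kernel_mass_nonneg[where 'n='n, of s] by simp
  define \<eta> where "\<eta> = min (M / 2) (\<kappa> / (2 * (P + 1)))"
  have "0 < \<eta>" unfolding \<eta>_def using M \<kappa> P by auto
  moreover have "\<eta> \<le> M / 2" unfolding \<eta>_def by (rule min.cobounded1)
  ultimately have \<eta>: "0 < \<eta>" "\<eta> \<le> M / 2" .
  have \<eta>P: "\<eta> * P \<le> \<kappa> / 2"
  proof -
    have "\<eta> * P \<le> \<kappa> / (2 * (P + 1)) * (P + 1)"
      using \<eta> P \<kappa> unfolding \<eta>_def by (intro mult_mono) auto
    also have "\<dots> = \<kappa> / 2" using P by (simp add: field_simps)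
    finally show ?thesis .
  qed
  define \<delta> where "\<delta> = \<eta> / 2"
  (* At the maxima of q the time derivative of w is at most - c \<kappa> / 2, strictly below - v. *)
  define v where "v = c * \<kappa> / 4"
  have v: "0 < v" unfolding v_def using c \<kappa> by simp
  obtain x0 t0 where x0: "M - \<delta> < w x0 t0" using near[of \<delta>] \<eta>(1) unfolding \<delta>_def by auto
  define q where "q x t = w x t - \<eta> * hole 1 x0 x" for x t
  define g where "g t = (SUP x\<in>cball x0 1. q x t)" for t
  have hole: "0 \<le> \<eta> * hole 1 x0 x" for x using hole_nonneg[of 1 x0 x] \<eta> by simp
  have qw: "q x t \<le> w x t" for x t using hole unfolding q_def by simp
  have cont_shift: "continuous_on S (\<lambda>x. u (x + h) t)" for S t
    by (rule continuous_on_compose2[OF cont_x]) (auto intro!: continuous_intros)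
  have cont_w: "continuous_on S (\<lambda>x. w x t)" for S t
    unfolding w_def by (intro continuous_intros cont_shift continuous_on_subset[OF cont_x]) auto
  have cont_q: "continuous_on S (\<lambda>x. q x t)" for S t
    unfolding q_def by (intro continuous_intros cont_w)
  have att: "\<exists>y\<in>cball x0 1. g t = q y t \<and> (\<forall>x\<in>cball x0 1. q x t \<le> q y t)" for t
  proof -
    have "\<exists>y\<in>cball x0 1. \<forall>x\<in>cball x0 1. q x t \<le> q y t"
      by (rule continuous_attains_sup) (auto simp: cont_q)
    then obtain y where y: "y \<in> cball x0 1" "\<forall>x\<in>cball x0 1. q x t \<le> q y t" by blast
    moreover have "g t = q y t" unfolding g_def by (rule cSup_eq_maximum) (use y in auto)
    ultimately show ?thesis by blast
  qed
  have g_ge: "q x t \<le> g t" if "x \<in> cball x0 1" for x t using att[of t] that by metis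
  have g_le: "g t \<le> M" for t using att[of t] qw wM by (metis order_trans)
  have g0: "M - \<delta> < g t0" using x0 g_ge[of x0 t0] unfolding q_def by simp
  have ascend: "\<exists>d>0. \<forall>\<tau>. 0 < \<tau> \<and> \<tau> < d \<longrightarrow> g t + v * \<tau> \<le> g (t - \<tau>)" if gt: "M - \<delta> \<le> g t" for t
  proof -
    obtain y where y: "y \<in> cball x0 1" "g t = q y t" "\<And>x. x \<in> cball x0 1 \<Longrightarrow> q x t \<le> q y t"
      using att[of t] by metis
    have mx: "q x t \<le> q y t" for x
    proof (cases "x \<in> cball x0 1")
      case False
      then have "hole 1 x0 x = 1" by (intro hole_outside) (auto simp: dist_norm norm_minus_commute)
      then have "q x t \<le> M - \<eta>" using wM[of x t] unfolding q_def by simp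
      then show ?thesis using gt y(2) \<eta> unfolding \<delta>_def by simp
    qed (rule y(3))
    have [measurable]: "(\<lambda>x. w x t) \<in> borel_measurable borel" "(\<lambda>x. q x t) \<in> borel_measurable borel"
      "(\<lambda>x. u (x + h) t) \<in> borel_measurable borel" "(\<lambda>x. \<eta> * hole 1 x0 x) \<in> borel_measurable borel"
      by (intro borel_measurable_continuous_onI cont_w cont_q cont_shift continuous_intros)+
    obtain N where N: "regular N (norm y + norm h) t" using regular_ex by blast
    have sh: "second_diff (\<lambda>x. u (x + h) t) y z = second_diff (\<lambda>x. u x t) (y + h) z" for z
      unfolding second_diff_def by (simp add: algebra_simps)
    have b1: "\<bar>second_diff (\<lambda>x. u (x + h) t) y z\<bar> \<le> N * trunc_sq z" for z
      unfolding sh by (rule regularD[OF N norm_triangle_ineq])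
    have b2: "\<bar>second_diff (\<lambda>x. u x t) y z\<bar> \<le> N * trunc_sq z" for z by (rule regularD[OF N]) simp
    have b3: "\<bar>second_diff (\<lambda>x. w x t) y z\<bar> \<le> (2 * N) * trunc_sq z" for z
      using b1[of z] b2[of z] unfolding w_def second_diff_diff by linarith
    have b4: "\<bar>second_diff (\<lambda>x. \<eta> * hole 1 x0 x) y z\<bar> \<le> (\<eta> * bump_bound 1) * trunc_sq z" for z
      using mult_left_mono[OF second_diff_hole_le[of 1 x0 y z], of \<eta>] \<eta>(1)
      unfolding second_diff_cmult by (simp add: abs_mult mult_ac)
    have b5: "\<bar>second_diff (\<lambda>x. q x t) y z\<bar> \<le> (2 * N + \<eta> * bump_bound 1) * trunc_sq z" for z
      using b3[of z] b4[of z] unfolding q_def second_diff_diff by (simp add: distrib_right)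
    have "\<kappa> \<le> frac_op s (\<lambda>x. q x t) y"
      unfolding \<kappa>_def
    proof (rule frac_op_ge_at_max[OF s _ b5 mx h n0])
      fix z :: "real ^ 'n"
      define a where "a k = u (y + (real k *\<^sub>R h + z)) t" for k :: nat
      have wa: "w (y + (real k *\<^sub>R h + z)) t = a (Suc k) - a k" for k
        unfolding w_def a_def by (simp add: algebra_simps)
      have "(\<Sum>k=1..n. w (y + (real k *\<^sub>R h + z)) t) = a (Suc n) - a 1"
        unfolding wa using n0 by (subst sum_Suc_diff) auto
      also have "\<dots> \<le> K" using range[of _ t] unfolding a_def by (smt (verit))
      finally have "(\<Sum>k=1..n. w (y + (real k *\<^sub>R h + z)) t) \<le> K" .
      moreover have "(\<Sum>k=1..n. q (y + (real k *\<^sub>R h + z)) t) \<le> (\<Sum>k=1..n. w (y + (real k *\<^sub>R h + z)) t)"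
        by (intro sum_mono qw)
      moreover have "K + 1 \<le> real n * q y t"
      proof -
        have "M / 2 \<le> q y t" using gt y(2) \<eta> M unfolding \<delta>_def by linarith
        then have "real n * (M / 2) \<le> real n * q y t" by (intro mult_left_mono) auto
        then show ?thesis using nM by simp
      qed
      ultimately show "1 \<le> (\<Sum>k=1..n. q y t - q (y + (real k *\<^sub>R h + z)) t)"
        by (simp add: sum_subtractf)
    qed measurable
    moreover have "frac_op s (\<lambda>x. q x t) y = frac_op s (\<lambda>x. w x t) y - frac_op s (\<lambda>x. \<eta> * hole 1 x0 x) y"
      unfolding q_def by (rule frac_op_diff[OF s _ _ b3 b4]) measurable
    moreover have "\<bar>frac_op s (\<lambda>x. \<eta> * hole 1 x0 x) y\<bar> \<le> (\<eta> * bump_bound 1) * kernel_mass TYPE('n) s"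
      by (rule frac_op_abs_le[OF s _ b4]) measurable
    moreover have "(\<eta> * bump_bound 1) * kernel_mass TYPE('n) s = \<eta> * P" unfolding P_def by simp
    ultimately have "\<kappa> / 2 \<le> frac_op s (\<lambda>x. w x t) y" using \<eta>P by linarith
    then have "c * (\<kappa> / 2) \<le> c * frac_op s (\<lambda>x. w x t) y" using c by (intro mult_left_mono) auto
    moreover have "frac_op s (\<lambda>x. w x t) y = frac_op s (\<lambda>x. u x t) (y + h) - frac_op s (\<lambda>x. u x t) y"
    proof -
      have "frac_op s (\<lambda>x. w x t) y = frac_op s (\<lambda>x. u (x + h) t) y - frac_op s (\<lambda>x. u x t) y"
        unfolding w_def by (rule frac_op_diff[OF s _ _ b1 b2]) measurable
      then show ?thesis unfolding frac_op_def sh .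
    qed
    ultimately have fr: "c * (\<kappa> / 2) \<le> c * frac_op s (\<lambda>x. u x t) (y + h) - c * frac_op s (\<lambda>x. u x t) y"
      by (simp add: right_diff_distrib)
    define D where "D = f (u (y + h) t) - c * frac_op s (\<lambda>x. u x t) (y + h)
        - (f (u y t) - c * frac_op s (\<lambda>x. u x t) y)"
    have "0 \<le> w y t" using gt y(2) qw[of y t] \<eta> M unfolding \<delta>_def by linarith
    then have "f (u (y + h) t) \<le> f (u y t)" using range unfolding w_def by (intro f_mono) auto
    moreover have "v < c * (\<kappa> / 2)" using c \<kappa> unfolding v_def by simp
    ultimately have D: "D + v < 0" using fr unfolding D_def by linarith
    have "((\<lambda>\<tau>. w y \<tau> + v * \<tau>) has_real_derivative D + v) (at t)"
    proof (rule DERIV_add)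
      show "(w y has_real_derivative D) (at t)"
        unfolding w_def[abs_def] D_def by (intro DERIV_diff evol)
      show "((*) v has_real_derivative v) (at t)" by (auto intro!: derivative_eq_intros)
    qed
    from DERIV_neg_dec_left[OF this D]
    obtain d where d: "d > 0" "\<And>\<tau>. 0 < \<tau> \<Longrightarrow> \<tau> < d \<Longrightarrow> w y t + v * t < w y (t - \<tau>) + v * (t - \<tau>)" by blast
    have "g t + v * \<tau> \<le> g (t - \<tau>)" if "0 < \<tau>" "\<tau> < d" for \<tau>
      using d(2)[OF that] g_ge[OF y(1), of "t - \<tau>"] y(2) unfolding q_def by (simp add: algebra_simps)
    then show ?thesis using d(1) by blast
  qed
  have semi: "\<exists>d>0. \<forall>t'. t \<le> t' \<and> t' < t + d \<longrightarrow> g t' \<le> g t + e" if e: "0 < e" for t e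
  proof -
    obtain B where B: "0 \<le> B"
      "\<And>x b. norm x \<le> norm x0 + 1 + norm h \<Longrightarrow> t < b \<Longrightarrow> \<bar>u x b - u x t\<bar> \<le> B * (b - t)"
      using locally_uniform_right_lipschitz[of "norm x0 + 1 + norm h" t] by blast
    define d where "d = e / (2 * B + 1)"
    have "g t' \<le> g t + e" if t': "t \<le> t'" "t' < t + d" for t'
    proof (cases "t' = t")
      case False
      then have tt: "t < t'" using t' by simp
      obtain y where y: "y \<in> cball x0 1" "g t' = q y t'" using att[of t'] by metis
      have ny: "norm y \<le> norm x0 + 1"
        using y(1) norm_triangle_ineq2[of y x0] by (simp add: dist_norm norm_minus_commute)
      then have "norm (y + h) \<le> norm x0 + 1 + norm h" using norm_triangle_ineq[of y h] by linarith
      then have "\<bar>u (y + h) t' - u (y + h) t\<bar> \<le> B * (t' - t)" using B(2) tt by blast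
      moreover have "\<bar>u y t' - u y t\<bar> \<le> B * (t' - t)"
        by (rule B(2)[OF _ tt]) (use ny norm_ge_zero[of h] in linarith)
      ultimately have "q y t' \<le> q y t + 2 * B * (t' - t)" unfolding q_def w_def by linarith
      also have "2 * B * (t' - t) \<le> (2 * B + 1) * d" using t' B(1) by (intro mult_mono) auto
      also have "(2 * B + 1) * d = e" unfolding d_def using B(1) by simp
      finally show ?thesis using g_ge[OF y(1), of t] y(2) by linarith
    qed (use e in simp)
    moreover have "d > 0" unfolding d_def using e B(1) by simp
    ultimately show ?thesis by blast
  qed
  (* After this time span the linear growth exceeds M - g t0, which is less than \<delta>. *)
  define b where "b = (\<delta> + 1) / v"
  have b: "0 \<le> b" "v * b = \<delta> + 1" unfolding b_def using v \<eta> unfolding \<delta>_def by auto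
  have "- g (t0 - b) \<le> - g (t0 - 0) + (- v) * (b - 0)"
  proof (rule continuous_induction_le[of "{0..b}" 0 b "\<lambda>\<tau>. - g (t0 - \<tau>)" "- v"])
    show "closed {0..b}" "0 \<in> {0..b}" "b \<in> {0..b}" "{0..b} \<subseteq> {0..b}" using b by auto
    fix \<tau> e :: real assume "0 < e"
    then obtain d where d: "d > 0" "\<And>t'. t0 - \<tau> \<le> t' \<Longrightarrow> t' < t0 - \<tau> + d \<Longrightarrow> g t' \<le> g (t0 - \<tau>) + e"
      using semi[of e "t0 - \<tau>"] by blast
    have "- g (t0 - \<tau>) \<le> - g (t0 - \<sigma>) + e" if "\<tau> - d < \<sigma>" "\<sigma> \<le> \<tau>" for \<sigma>
      using d(2)[of "t0 - \<sigma>"] that by simp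
    then show "\<exists>d>0. \<forall>\<sigma>\<in>{0..b}. \<tau> - d < \<sigma> \<and> \<sigma> \<le> \<tau> \<longrightarrow> - g (t0 - \<tau>) \<le> - g (t0 - \<sigma>) + e"
      using d(1) by blast
  next
    fix \<tau> assume \<tau>: "\<tau> \<in> {0..b}" "\<tau> < b" "- g (t0 - \<tau>) \<le> - g (t0 - 0) + (- v) * (\<tau> - 0)"
    have "0 \<le> v * \<tau>" using \<tau>(1) v by simp
    then have "M - \<delta> \<le> g (t0 - \<tau>)" using \<tau>(3) g0 by simp
    then obtain d where d: "d > 0" "\<And>\<sigma>. 0 < \<sigma> \<Longrightarrow> \<sigma> < d \<Longrightarrow> g (t0 - \<tau>) + v * \<sigma> \<le> g (t0 - \<tau> - \<sigma>)"
      using ascend by blast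
    define e where "e = min (d / 2) (b - \<tau>)"
    have "0 < e" "e < d" "\<tau> + e \<le> b" unfolding e_def using d(1) \<tau>(2) by auto
    then show "\<exists>\<sigma>\<in>{0..b}. \<tau> < \<sigma> \<and> - g (t0 - \<sigma>) \<le> - g (t0 - \<tau>) + - v * (\<sigma> - \<tau>)"
      using d(2)[of e] \<tau>(1) by (intro bexI[of _ "\<tau> + e"]) (auto simp: diff_diff_eq)
  qed
  then show False using g0 g_le[of "t0 - b"] b(2) by simp
qed

lemma space_independent: "u x t = u y t"
  using translate_le[of x "y - x" t] translate_le[of y "x - y" t] by simp

end

section \<open>Classification of the solutions\<close>

lemma GDERIV_along_line:
  fixes v :: "'a::real_inner \<Rightarrow> real"
  assumes "\<And>y. GDERIV v y :> g y"
  shows "((\<lambda>t. v (x + t *\<^sub>R z)) has_real_derivative inner z (g (x + t *\<^sub>R z))) (at t)"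
proof -
  have 1: "((\<lambda>t. x + t *\<^sub>R z) has_derivative (\<lambda>d. d *\<^sub>R z)) (at t)"
    by (auto intro!: derivative_eq_intros)
  have "(v has_derivative (\<lambda>h. inner h (g (x + t *\<^sub>R z)))) (at (x + t *\<^sub>R z))"
    using assms[of "x + t *\<^sub>R z"] unfolding gderiv_def .
  from diff_chain_at[OF 1 this]
  have "((\<lambda>t. v (x + t *\<^sub>R z)) has_derivative (\<lambda>d. inner (d *\<^sub>R z) (g (x + t *\<^sub>R z)))) (at t)"
    by (simp add: o_def)
  moreover have "(\<lambda>d. inner (d *\<^sub>R z) (g (x + t *\<^sub>R z))) = (*) (inner z (g (x + t *\<^sub>R z)))"
    by (simp add: fun_eq_iff mult.commute)
  ultimately show ?thesis unfolding has_field_derivative_def by simp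
qed

text \<open>The function \<open>t \<mapsto> v (x + t z) + v (x - t z)\<close> has derivative \<open>z \<bullet> (g (x + t z) - g (x - t z))\<close>, which is
\<open>O(|z|\<^sup>2)\<close> by the Lipschitz condition.\<close>

lemma C11_loc_second_diff:
  fixes v :: "real ^ 'n \<Rightarrow> real"
  assumes v: "v \<in> C11_loc" and K: "\<And>y. \<bar>v y\<bar> \<le> K"
  shows "\<exists>N. \<forall>x z. norm x \<le> R \<longrightarrow> \<bar>second_diff v x z\<bar> \<le> N * trunc_sq z"
proof -
  obtain g where g: "\<And>y. GDERIV v y :> g y" "\<And>S. compact S \<Longrightarrow> \<exists>L. L-lipschitz_on S g"
    using v unfolding C11_loc_def by blast
  obtain L where L: "L-lipschitz_on (cball 0 (R + 1)) g" using g(2)[OF compact_cball] by blast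
  have "\<bar>second_diff v x z\<bar> \<le> max (2 * L) (4 * K) * trunc_sq z" if x: "norm x \<le> R" for x z
  proof (rule second_diff_le_trunc_sq[OF K])
    fix z :: "real ^ 'n" assume z: "norm z \<le> 1"
    define q where "q t = v (x + t *\<^sub>R z) + v (x + t *\<^sub>R (- z))" for t
    define D where "D t = inner z (g (x + t *\<^sub>R z)) + inner (- z) (g (x + t *\<^sub>R (- z)))" for t
    have "(q has_real_derivative D t) (at t)" for t
      unfolding q_def[abs_def] D_def by (intro DERIV_add GDERIV_along_line g(1))
    then obtain \<xi> where \<xi>: "0 < \<xi>" "\<xi> < 1" "q 1 - q 0 = (1 - 0) * D \<xi>"
      using MVT2[of 0 1 q D] by auto
    have "\<bar>D \<xi>\<bar> = \<bar>inner z (g (x + \<xi> *\<^sub>R z) - g (x - \<xi> *\<^sub>R z))\<bar>"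
      unfolding D_def by (simp add: inner_diff_right)
    also have "\<dots> \<le> norm z * norm (g (x + \<xi> *\<^sub>R z) - g (x - \<xi> *\<^sub>R z))" by (rule Cauchy_Schwarz_ineq2)
    also have "\<dots> \<le> norm z * (L * (2 * norm z))"
    proof (rule mult_left_mono)
      have \<xi>z: "norm (\<xi> *\<^sub>R z) \<le> norm z" using \<xi> by (simp add: mult_left_le_one_le)
      have "norm (x + \<xi> *\<^sub>R z) \<le> R + 1" "norm (x - \<xi> *\<^sub>R z) \<le> R + 1"
        using norm_triangle_ineq[of x "\<xi> *\<^sub>R z"] norm_triangle_ineq4[of x "\<xi> *\<^sub>R z"] x z \<xi>z by linarith+
      then have "dist (g (x + \<xi> *\<^sub>R z)) (g (x - \<xi> *\<^sub>R z)) \<le> L * dist (x + \<xi> *\<^sub>R z) (x - \<xi> *\<^sub>R z)"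
        by (intro lipschitz_onD[OF L]) auto
      moreover have "dist (x + \<xi> *\<^sub>R z) (x - \<xi> *\<^sub>R z) \<le> 2 * norm z"
      proof -
        have "(x + \<xi> *\<^sub>R z) - (x - \<xi> *\<^sub>R z) = \<xi> *\<^sub>R z + \<xi> *\<^sub>R z" by simp
        then show ?thesis using \<xi>z norm_triangle_ineq[of "\<xi> *\<^sub>R z" "\<xi> *\<^sub>R z"] unfolding dist_norm by simp
      qed
      ultimately show "norm (g (x + \<xi> *\<^sub>R z) - g (x - \<xi> *\<^sub>R z)) \<le> L * (2 * norm z)"
        using lipschitz_on_nonneg[OF L] unfolding dist_norm by (meson mult_left_mono order_trans)
    qed simp
    finally have "\<bar>D \<xi>\<bar> \<le> 2 * L * (norm z)\<^sup>2" by (simp add: power2_eq_square mult_ac)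
    moreover have "second_diff v x z = - (q 1 - q 0)" unfolding second_diff_def q_def by simp
    ultimately show "\<bar>second_diff v x z\<bar> \<le> 2 * L * (norm z)\<^sup>2" using \<xi>(3) by simp
  qed
  then show ?thesis by blast
qed

lemma C11_loc_continuous: "v \<in> C11_loc \<Longrightarrow> continuous_on UNIV v"
  unfolding C11_loc_def gderiv_def
  by (auto intro!: continuous_at_imp_continuous_on dest: has_derivative_continuous)

lemma nonincreasing_of_derivative:
  fixes f f' :: "real \<Rightarrow> real"
  assumes "\<And>c. c \<ge> 0 \<Longrightarrow> (f has_real_derivative f' c) (at c within {0..})"
    and "\<And>c. c \<ge> 0 \<Longrightarrow> f' c \<le> 0" and ab: "0 \<le> a" "a \<le> b"
  shows "f b \<le> f a"
proof (cases "a = b")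
  case False
  then have "a < b" using ab by simp
  then have "\<exists>x\<in>{a<..<b}. f b - f a = (\<lambda>h. f' x * h) (b - a)"
  proof (rule mvt_simple)
    fix x assume "a \<le> x" "x \<le> b"
    then have "(f has_real_derivative f' x) (at x within {a..b})"
      using ab by (intro DERIV_subset[OF assms(1)]) auto
    then show "(f has_derivative (\<lambda>h. f' x * h)) (at x within {a..b})"
      unfolding has_field_derivative_def .
  qed
  then obtain x where x: "a < x" "f b - f a = f' x * (b - a)" by auto
  have "f' x * (b - a) \<le> 0" using assms(2)[of x] x(1) ab by (intro mult_nonpos_nonneg) auto
  then show ?thesis using x(2) by simp
qed simp

text \<open>If \<open>f (U t0) < 0\<close>, then \<open>U \<ge> U t0\<close> at all earlier times, so \<open>U\<close> decreases there at least at the rate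
\<open>-f (U t0)\<close> and was unbounded in the past.\<close>

lemma bounded_ancient_no_decay:
  fixes U f :: "real \<Rightarrow> real"
  assumes der: "\<And>t. (U has_real_derivative f (U t)) (at t)"
    and U: "\<And>t. 0 \<le> U t" "\<And>t. U t \<le> K"
    and f: "\<And>a b. 0 \<le> a \<Longrightarrow> a \<le> b \<Longrightarrow> f b \<le> f a" "\<And>a. 0 \<le> a \<Longrightarrow> f a \<le> 0"
  shows "0 \<le> f (U t0)"
proof (rule ccontr)
  define m where "m = - f (U t0)"
  assume "\<not> ?thesis"
  then have m: "0 < m" unfolding m_def by simp
  have dec: "U b \<le> U a" if "a \<le> b" for a b
    using DERIV_nonpos_imp_nonincreasing[OF that, of U] der U(1) f(2) by blast
  define T where "T = (K + 1) / m"
  have K: "0 \<le> K" using U order_trans by blast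
  have T: "0 \<le> T" "m * T = K + 1" unfolding T_def using K m by auto
  have "U t0 + m * t0 \<le> U (t0 - T) + m * (t0 - T)"
  proof (rule DERIV_nonpos_imp_nonincreasing[of "t0 - T" t0 "\<lambda>t. U t + m * t"])
    fix t assume "t0 - T \<le> t" "t \<le> t0"
    then have "f (U t) \<le> f (U t0)" using dec U(1) f(1) by blast
    then have "f (U t) + m \<le> 0" unfolding m_def by simp
    moreover have "((\<lambda>t. U t + m * t) has_real_derivative f (U t) + m) (at t)"
      by (auto intro!: derivative_eq_intros der)
    ultimately show "\<exists>y. ((\<lambda>t. U t + m * t) has_real_derivative y) (at t) \<and> y \<le> 0" by blast
  qed (use T in simp)
  then show False using T U(1)[of t0] U(2)[of "t0 - T"] by (simp add: algebra_simps)
qed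

lemma solution_frac_flow:
  fixes u :: "real ^ 'n \<Rightarrow> real \<Rightarrow> real"
  assumes s: "0 < s" "s < 1" and f: "continuous_on {0..} f" "\<And>a b. 0 \<le> a \<Longrightarrow> a \<le> b \<Longrightarrow> f b \<le> f a"
    and sol: "nonneg_bounded_solution s f u"
  obtains K where "frac_flow s (frac_laplacian_const TYPE('n) s) K f u"
proof -
  have C11: "(\<lambda>x. u x t) \<in> C11_loc" for t using sol unfolding nonneg_bounded_solution_def by blast
  have C1: "u x C1_differentiable_on UNIV" for x using sol unfolding nonneg_bounded_solution_def by blast
  have pos: "0 \<le> u x t" for x t using sol unfolding nonneg_bounded_solution_def by blast
  have bd: "bounded (range (\<lambda>(x, t). u x t))" using sol unfolding nonneg_bounded_solution_def by blast
  have eq: "deriv (u x) t + frac_laplacian s (\<lambda>y. u y t) x = f (u x t)" for x t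
    using sol unfolding nonneg_bounded_solution_def by blast
  obtain K where K: "\<bar>u x t\<bar> \<le> K" for x t using bd unfolding bounded_iff by auto
  have cont: "continuous_on UNIV (\<lambda>x. u x t)" for t by (rule C11_loc_continuous[OF C11])
  show ?thesis
  proof (rule that[of K], unfold_locales)
    show "0 < frac_laplacian_const TYPE('n) s" by (rule frac_laplacian_const_pos[OF s])
    show "u x t \<le> K" for x t using K[of x t] by linarith
    show "\<exists>N. \<forall>x z. norm x \<le> R \<longrightarrow> \<bar>second_diff (\<lambda>y. u y t) x z\<bar> \<le> N * trunc_sq z" for t R
      by (rule C11_loc_second_diff[OF C11 K])
    show "continuous_on {0..K} f" by (rule continuous_on_subset[OF f(1)]) auto
    show "(u x has_real_derivative f (u x t) - frac_laplacian_const TYPE('n) s * frac_op s (\<lambda>y. u y t) x) (at t)" for x t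
    proof -
      obtain N where N: "\<And>z. \<bar>second_diff (\<lambda>y. u y t) x z\<bar> \<le> N * trunc_sq z"
        using C11_loc_second_diff[OF C11 K, of "norm x" t] by blast
      have "frac_laplacian s (\<lambda>y. u y t) x = frac_laplacian_const TYPE('n) s * frac_op s (\<lambda>y. u y t) x"
        by (rule frac_laplacian_eq_frac_op[OF s borel_measurable_continuous_onI[OF cont] K N])
      moreover have "(u x has_real_derivative deriv (u x) t) (at t)"
        using C1_diff_imp_diff[OF C1] by (simp add: DERIV_deriv_iff_real_differentiable differentiable_on_def)
      moreover have "f (u x t) - frac_laplacian s (\<lambda>y. u y t) x = deriv (u x) t" using eq[of x t] by linarith
      ultimately show ?thesis by simp
    qed
  qed (use s pos cont f(2) in auto)
qed

lemma zero_solution: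
  assumes "f 0 = 0"
  shows "nonneg_bounded_solution s f (\<lambda>x t. 0)"
proof -
  have "(\<lambda>x::real^'n. 0::real) \<in> C11_loc"
    unfolding C11_loc_def by (auto intro!: exI[of _ "\<lambda>x. 0"] GDERIV_const exI[of _ 0] simp: lipschitz_on_def)
  moreover have "(\<lambda>x::real^'n. 0::real) \<in> L2s s" unfolding L2s_def by simp
  moreover have "frac_laplacian s (\<lambda>y::real^'n. 0) x = 0" for x
    unfolding frac_laplacian_def by (simp add: tendsto_Lim trivial_limit_at_right_real)
  ultimately show ?thesis using assms unfolding nonneg_bounded_solution_def by (auto simp: case_prod_unfold)
qed

theorem theorem1p8:
  fixes s :: real and f f' :: "real \<Rightarrow> real"
  assumes "0 < s" and "s < 1"
    and "\<And>c. c \<ge> 0 \<Longrightarrow> (f has_real_derivative f' c) (at c within {0..})"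
    and "continuous_on {0..} f'"
    and "\<And>c. c \<ge> 0 \<Longrightarrow> f' c \<le> 0"
  shows "(\<forall>u :: real ^ 'n \<Rightarrow> real \<Rightarrow> real. nonneg_bounded_solution s f u \<longrightarrow>
           (\<exists>U. (\<forall>x t. u x t = U t) \<and> (\<forall>t. (U has_real_derivative f (U t)) (at t)))) \<and>
         ((\<forall>c\<ge>0. f c = 0 \<longleftrightarrow> c = 0) \<longrightarrow>
           (\<forall>u :: real ^ 'n \<Rightarrow> real \<Rightarrow> real.
             nonneg_bounded_solution s f u \<longleftrightarrow> u = (\<lambda>x t. 0))) \<and>
         ((\<forall>c\<ge>0. f c < 0) \<longrightarrow>
           \<not> (\<exists>u :: real ^ 'n \<Rightarrow> real \<Rightarrow> real. nonneg_bounded_solution s f u))"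
proof -
  have mono: "f b \<le> f a" if "0 \<le> a" "a \<le> b" for a b
    by (rule nonincreasing_of_derivative[OF assms(3,5) that])
  have cont: "continuous_on {0..} f"
    using assms(3) by (meson atLeast_iff has_field_derivative_imp_has_derivative has_derivative_continuous_on)
  have main: "\<exists>U K. (\<forall>x t. u x t = U t) \<and> (\<forall>t. (U has_real_derivative f (U t)) (at t))
      \<and> (\<forall>t. 0 \<le> U t \<and> U t \<le> K)"
    if sol: "nonneg_bounded_solution s f u" for u :: "real ^ 'n \<Rightarrow> real \<Rightarrow> real"
  proof -
    obtain K where "frac_flow s (frac_laplacian_const TYPE('n) s) K f u"
      using solution_frac_flow[OF assms(1,2) cont mono sol] by blast
    then interpret frac_flow s "frac_laplacian_const TYPE('n) s" K f u .
    have same: "u x t = u 0 t" for x t by (rule space_independent)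
    have "(u 0 has_real_derivative f (u 0 t)) (at t)" for t
    proof -
      have "second_diff (\<lambda>y. u y t) 0 z = 0" for z unfolding second_diff_def using same[of "0 + z" t] same[of "0 - z" t] by linarith
      then have "frac_op s (\<lambda>y. u y t) 0 = 0" unfolding frac_op_def by simp
      then show ?thesis using evol[of 0 t] by simp
    qed
    then show ?thesis by (intro exI[of _ "u 0"] exI[of _ K] conjI allI same range)
  qed
  have no_decay: "\<forall>c\<ge>0. f c \<le> 0 \<Longrightarrow> 0 \<le> f (u x t)"
    if sol: "nonneg_bounded_solution s f u" for u :: "real ^ 'n \<Rightarrow> real \<Rightarrow> real" and x t
  proof -
    assume neg: "\<forall>c\<ge>0. f c \<le> 0"
    obtain U K where U: "\<And>x t. u x t = U t" "\<And>t. (U has_real_derivative f (U t)) (at t)"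
      "\<And>t. 0 \<le> U t" "\<And>t. U t \<le> K" using main[OF sol] by blast
    have "0 \<le> f (U t)"
      by (rule bounded_ancient_no_decay[OF U(2-4) mono]) (use neg in auto)
    then show ?thesis using U(1) by simp
  qed
  have pos: "0 \<le> u x t" if "nonneg_bounded_solution s f u" for u :: "real ^ 'n \<Rightarrow> real \<Rightarrow> real" and x t
    using that unfolding nonneg_bounded_solution_def by blast
  show ?thesis
  proof (intro conjI impI allI)
    fix u :: "real ^ 'n \<Rightarrow> real \<Rightarrow> real"
    assume "nonneg_bounded_solution s f u"
    then show "\<exists>U. (\<forall>x t. u x t = U t) \<and> (\<forall>t. (U has_real_derivative f (U t)) (at t))"
      using main by blast
  next
    fix u :: "real ^ 'n \<Rightarrow> real \<Rightarrow> real"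
    assume zero: "\<forall>c\<ge>0. f c = 0 \<longleftrightarrow> c = 0"
    then have f0: "f 0 = 0" by simp
    then have neg: "\<forall>c\<ge>0. f c \<le> 0" using mono[of 0] by simp
    show "nonneg_bounded_solution s f u \<longleftrightarrow> u = (\<lambda>x t. 0)"
    proof
      assume sol: "nonneg_bounded_solution s f u"
      have "u x t = 0" for x t
        using no_decay[OF sol neg, of x t] neg pos[OF sol, of x t] zero by (metis order_antisym)
      then show "u = (\<lambda>x t. 0)" by blast
    next
      assume "u = (\<lambda>x t. 0)"
      then show "nonneg_bounded_solution s f u" using zero_solution[of f s, OF f0] by simp
    qed
  next
    assume neg: "\<forall>c\<ge>0. f c < 0"
    show "\<not> (\<exists>u :: real ^ 'n \<Rightarrow> real \<Rightarrow> real. nonneg_bounded_solution s f u)"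
    proof
      assume "\<exists>u :: real ^ 'n \<Rightarrow> real \<Rightarrow> real. nonneg_bounded_solution s f u"
      then obtain u :: "real ^ 'n \<Rightarrow> real \<Rightarrow> real" where sol: "nonneg_bounded_solution s f u" by blast
      have "\<forall>c\<ge>0. f c \<le> 0" using neg by (simp add: less_imp_le)
      then have "0 \<le> f (u 0 0)" by (rule no_decay[OF sol])
      then show False using neg pos[OF sol, of 0 0] by (meson not_less)
    qed
  qed
qed

end
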